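(* Let $d \ge 2$, $p \in (d,+\infty)$, $q \in (d,+\infty]$, and $\theta \in [\theta_c,1]$, where $\theta_c \in [0,1)$ is defined by $$\frac{1}{\theta_c} = 1 + \frac{dp+2p}{dp+2d}\left(\frac{q}{d} - 1\right)$$ (so $\theta_c = 0$ if $q=+\infty$). Define $\alpha,\beta,\gamma \in [0,1)$ by $$\alpha = (1-\theta)\frac{d}{d+2} + \theta\frac{p}{p+2}, \qquad \beta = (1-\theta)\frac{2}{d+2}, \qquad \gamma = \theta\frac{2}{p+2}.$$ Then there exists $C<\infty$ (depending only on $d,p,q,\theta$) such that for all functions $f:\mathbb{Z}^d\to\mathbb{R}$ and $w:\mathbb{B}\to[0,\infty)$, $$\|f\|_2 \le C\,\big(\mathcal{M}_q\,\|w\,\nabla f\|_2\big)^{\alpha}\ \|f\|_1^{\beta}\ \big\||x|_*^{p/2} f\big\|_2^{\gamma},$$ where $$\mathcal{M}_q^q = \mathcal{M}_q^q(w) = \sup_{r\ge 1}\frac{1}{|\mathbb{B}_r|}\sum_{e\in\mathbb{B}_r} w(e)^{-q}$$ (supremum over positive integers $r$; for $q=+\infty$, $\mathcal{M}_\infty(w) = \sup_{e\in\mathbb{B}} w(e)^{-1}$).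
   Context: $\mathbb{B}$ is the set of unoriented nearest-neighbour edges of $\mathbb{Z}^d$. For a positive integer $r$, $B_r=\{-r,\dots,r\}^d$ and $\mathbb{B}_r$ is the set of edges with both endpoints in $B_r$. $|\cdot|$ is the Euclidean norm and $|x|_* = \max(|x|,1)$. For $f:\mathbb{Z}^d\to\mathbb{R}$ and $e=\{x,y\}\in\mathbb{B}$, $\nabla f(e)$ is the difference of $f$ across $e$ (only $|\nabla f(e)|=|f(x)-f(y)|$ matters). $\|\cdot\|_p$ denotes the $\ell^p$ norm with respect to counting measure on $\mathbb{Z}^d$ or on $\mathbb{B}$ according to the argument; $|x|_*^{p/2}f$ denotes the function $x\mapsto |x|_*^{p/2}f(x)$, and $w\nabla f$ the function $e\mapsto w(e)\nabla f(e)$. Conventions: $0^{-1}=+\infty$; a factor with exponent $0$ equals $1$; the right-hand side is $+\infty$ (inequality trivially true) whenever $\mathcal{M}_q=+\infty$ or one of the remaining factors is infinite. *)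

theory Defs
  imports "HOL-Analysis.Analysis"
begin

subsection \<open>Arithmetic on \<open>[0,\<infinity>]\<close>\<close>

text \<open>Real powers with \<open>0\<^sup>-\<^sup>1 = \<infinity>\<close> and \<open>x\<^sup>0 = 1\<close> for every \<open>x\<close>, including \<open>0\<close> and \<open>\<infinity>\<close>;
  note that \<open>0 powr 0 = 0\<close> on the reals.\<close>

definition epowr :: "ennreal \<Rightarrow> real \<Rightarrow> ennreal" (infixr "epowr" 80) where
  "x epowr a =
    (if a = 0 then 1
     else if x = top then (if a > 0 then top else 0)
     else if x = 0 \<and> a < 0 then top
     else ennreal (enn2real x powr a))"

text \<open>Multiplication with \<open>\<infinity> \<cdot> 0 = \<infinity>\<close>, so that a product is infinite as soon as one of its factors
  is; the multiplication of \<^typ>\<open>ennreal\<close> has \<open>\<infinity> \<cdot> 0 = 0\<close>.\<close>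

definition itimes :: "ennreal \<Rightarrow> ennreal \<Rightarrow> ennreal" (infixl "\<odot>" 70) where
  "x \<odot> y = (if x = top \<or> y = top then top else x * y)"

text \<open>The \<open>\<ell>\<^sup>p\<close> norm (for \<open>0 < p < \<infinity>\<close>) with respect to counting measure on \<open>S\<close>.\<close>

definition lnorm :: "real \<Rightarrow> 'a set \<Rightarrow> ('a \<Rightarrow> real) \<Rightarrow> ennreal" where
  "lnorm p S f = (\<integral>\<^sup>+ x. ennreal (\<bar>f x\<bar> powr p) \<partial>count_space S) epowr (1 / p)"

subsection \<open>The lattice \<open>\<int>\<^sup>d\<close>, with \<open>d = CARD('n)\<close>\<close>

definition znorm :: "int ^ 'n \<Rightarrow> real" where
  "znorm x = norm (\<chi> i. real_of_int (x $ i))"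

definition znorm_star :: "int ^ 'n \<Rightarrow> real" where
  "znorm_star x = max (znorm x) 1"

definition lattice_edges :: "(int ^ 'n) set set" where
  "lattice_edges = {{x, y} | x y. znorm (x - y) = 1}"

definition box_Z :: "nat \<Rightarrow> (int ^ 'n) set" where
  "box_Z r = {x. \<forall>i. - int r \<le> x $ i \<and> x $ i \<le> int r}"

definition box_edges :: "nat \<Rightarrow> (int ^ 'n) set set" where
  "box_edges r = {e \<in> lattice_edges. e \<subseteq> box_Z r}"

text \<open>The modulus of \<open>\<nabla>f\<close> on an unoriented edge.\<close>

definition abs_grad :: "('a \<Rightarrow> real) \<Rightarrow> 'a set \<Rightarrow> real" where
  "abs_grad f e = Max (f ` e) - Min (f ` e)"

lemma abs_grad_edge: "abs_grad f {x, y} = \<bar>f x - f y\<bar>"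
  by (simp add: abs_grad_def max_def min_def)

subsection \<open>The moment \<open>\<M>\<^sub>q\<close>\<close>

definition moment_M :: "ereal \<Rightarrow> ((int ^ 'n) set \<Rightarrow> real) \<Rightarrow> ennreal" where
  "moment_M q w =
    (if q = \<infinity> then (SUP e\<in>lattice_edges. ennreal (w e) epowr (- 1))
     else (SUP r\<in>{1..}. (\<Sum>e\<in>box_edges r. ennreal (w e) epowr (- real_of_ereal q))
                           / of_nat (card (box_edges r :: (int ^ 'n) set set)))
            epowr (1 / real_of_ereal q))"

subsection \<open>Exponents\<close>

definition theta_c :: "real \<Rightarrow> real \<Rightarrow> ereal \<Rightarrow> real" where
  "theta_c d p q =
    (if q = \<infinity> then 0
     else 1 / (1 + (d * p + 2 * p) / (d * p + 2 * d) * (real_of_ereal q / d - 1)))"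

definition exp_alpha :: "real \<Rightarrow> real \<Rightarrow> real \<Rightarrow> real" where
  "exp_alpha d p \<theta> = (1 - \<theta>) * (d / (d + 2)) + \<theta> * (p / (p + 2))"

definition exp_beta :: "real \<Rightarrow> real \<Rightarrow> real" where
  "exp_beta d \<theta> = (1 - \<theta>) * (2 / (d + 2))"

definition exp_gamma :: "real \<Rightarrow> real \<Rightarrow> real" where
  "exp_gamma p \<theta> = \<theta> * (2 / (p + 2))"

lemma theta_c_bounds:
  assumes "d > 0" "p > 0" "q > ereal d"
  shows "theta_c d p q \<in> {0..<1}"
proof (cases q)
  case (real q')
  have "(d * p + 2 * p) / (d * p + 2 * d) * (q' / d - 1) > 0"
    using assms real by (intro mult_pos_pos divide_pos_pos add_pos_pos) auto
  then show ?thesis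
    using real by (simp add: theta_c_def)
qed (use assms in \<open>auto simp: theta_c_def\<close>)

lemma exponent_bounds:
  assumes "d > 0" "p > 0" "0 \<le> \<theta>" "\<theta> \<le> 1"
  shows "exp_alpha d p \<theta> \<in> {0..<1}" "exp_beta d \<theta> \<in> {0..<1}" "exp_gamma p \<theta> \<in> {0..<1}"
proof -
  have "exp_alpha d p \<theta> < 1"
  proof (cases "\<theta> = 1")
    case True
    then show ?thesis using assms by (simp add: exp_alpha_def)
  next
    case False
    have "(1 - \<theta>) * (d / (d + 2)) < (1 - \<theta>) * 1"
      using assms False by (intro mult_strict_left_mono) auto
    moreover have "\<theta> * (p / (p + 2)) \<le> \<theta> * 1"
      using assms by (intro mult_left_mono) auto
    ultimately show ?thesis by (simp add: exp_alpha_def)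
  qed
  then show "exp_alpha d p \<theta> \<in> {0..<1}"
    using assms by (simp add: exp_alpha_def)
  have "(1 - \<theta>) * (2 / (d + 2)) \<le> 1 * (2 / (d + 2))"
    using assms by (intro mult_right_mono) auto
  also have "\<dots> < 1" using assms by simp
  finally show "exp_beta d \<theta> \<in> {0..<1}"
    using assms by (simp add: exp_beta_def)
  have "\<theta> * (2 / (p + 2)) \<le> 1 * (2 / (p + 2))"
    using assms by (intro mult_right_mono) auto
  also have "\<dots> < 1" using assms by simp
  finally show "exp_gamma p \<theta> \<in> {0..<1}"
    using assms by (simp add: exp_gamma_def)
qed

end

theory Submission
  imports Defs
begin

text \<open>
  Halving a box \<open>B\<close> with halves \<open>B\<^sub>1, B\<^sub>2\<close> decreases the variance of \<open>f\<close> by the squared difference of the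
  two sums of \<open>f\<close>, divided by \<open>|B|\<close>. That difference is a sum of gradients, so by Cauchy-Schwarz and
  Hoelder it is controlled by the weighted energy and by the \<open>q\<close>-th moment of \<open>1/w\<close>; the bound is
  proportional to \<open>h powr (2 - 2d/q)\<close> for side length \<open>h\<close>. As \<open>q > d\<close>, summation over dyadic scales
  is geometric, and at scales \<open>\<rho> \<le> R\<close> one gets, with \<open>D = \<M>\<^sub>q \<parallel>w \<nabla>f\<parallel>\<^sub>2\<close>, \<open>N = \<parallel>f\<parallel>\<^sub>1\<close>
  and \<open>W\<close> the weighted norm,
  \<open>\<parallel>f\<parallel>\<^sup>2 \<le> C ((\<rho> powr (1 - d/q) R powr (d/q) D)\<^sup>2 + \<rho> powr (- d) N\<^sup>2 + R powr (- p) W\<^sup>2)\<close>.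
  Making the three terms equal gives the case \<open>\<theta> = \<theta>\<^sub>c\<close>. For \<open>\<rho> = R\<close> the middle term can be absorbed by
  splitting the \<open>\<ell>\<^sup>1\<close> norm at a small multiple of \<open>R\<close>, which gives the case \<open>\<theta> = 1\<close>; the remaining
  cases follow by interpolation.
\<close>

subsection \<open>Boxes in the lattice and their halving\<close>

definition zbox :: "int ^ 'n \<Rightarrow> int ^ 'n \<Rightarrow> (int ^ 'n) set" where
  "zbox a l = {x. \<forall>i. a $ i \<le> x $ i \<and> x $ i < a $ i + l $ i}"

text \<open>A cube of side \<open>2 * h\<close> arises from cubes of side \<open>h\<close> by
  doubling one coordinate at a time; \<open>S\<close> records the coordinates already
  doubled.\<close>

definition sides :: "'n set \<Rightarrow> int \<Rightarrow> int ^ 'n" where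
  "sides S h = (\<chi> i. if i \<in> S then 2 * h else h)"

text \<open>The pair \<open>(x, i)\<close> stands for the edge \<open>{x, x + axis i 1}\<close>.\<close>

definition steps :: "(int ^ 'n) set \<Rightarrow> ((int ^ 'n) \<times> 'n) set" where
  "steps B = {(x, i). x \<in> B \<and> x + axis i 1 \<in> B}"

lemma zbox_eq_PiE:
  "zbox a l = vec_lambda ` (\<Pi>\<^sub>E i\<in>UNIV. {a $ i..<a $ i + l $ i})"
proof -
  have "x \<in> vec_lambda ` (\<Pi>\<^sub>E i\<in>UNIV. {a $ i..<a $ i + l $ i})" if "x \<in> zbox a l" for x
    using that by (intro image_eqI[of _ _ "vec_nth x"]) (auto simp: zbox_def)
  then show ?thesis by (auto simp: zbox_def)
qed

lemma finite_zbox [simp]: "finite (zbox (a :: int ^ 'n) l)"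
  unfolding zbox_eq_PiE by (intro finite_imageI finite_PiE) auto

lemma card_zbox: "card (zbox (a :: int ^ 'n::finite) l) = (\<Prod>i\<in>UNIV. nat (l $ i))"
proof -
  have "inj_on vec_lambda (\<Pi>\<^sub>E i\<in>UNIV. {a $ i..<a $ i + l $ i})"
    by (auto simp: inj_on_def vec_lambda_inject)
  then show ?thesis
    unfolding zbox_eq_PiE by (simp add: card_image card_PiE)
qed

lemma card_zbox_sides_ge:
  assumes "h > 0"
  shows "card (zbox a (sides S h :: int ^ 'n::finite)) \<ge> nat h ^ CARD('n)"
proof -
  have "(\<Prod>i\<in>(UNIV::'n set). nat h) \<le> (\<Prod>i\<in>UNIV. nat ((sides S h :: int ^ 'n) $ i))"
    using assms by (intro prod_mono) (auto simp: sides_def)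
  then show ?thesis by (simp add: card_zbox)
qed

lemma card_zbox_cube: "card (zbox a (sides {} h :: int ^ 'n::finite)) = nat h ^ CARD('n)"
  by (simp add: card_zbox sides_def)

lemma sides_UNIV: "sides UNIV h = sides {} (2 * h)"
  by (simp add: sides_def)

lemma zbox_half:
  assumes "i \<notin> S" "h > 0"
  shows "zbox a (sides (insert i S) h) = zbox a (sides S h) \<union> zbox (a + axis i h) (sides S h)"
    and "zbox a (sides S h) \<inter> zbox (a + axis i h) (sides S h) = {}"
proof -
  have *: "(axis i h :: int ^ 'a) $ j = (if j = i then h else 0)" for j
    by (simp add: axis_def)
  have "x \<in> zbox a (sides (insert i S) h) \<longleftrightarrow>
      x \<in> zbox a (sides S h) \<or> x \<in> zbox (a + axis i h) (sides S h)" for x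
  proof (cases "x $ i < a $ i + h")
    case True
    then show ?thesis using assms
      by (simp add: zbox_def sides_def * split: if_splits) (smt (verit))
  next
    case False
    then show ?thesis using assms
      by (simp add: zbox_def sides_def * split: if_splits) (smt (verit))
  qed
  then show "zbox a (sides (insert i S) h) = zbox a (sides S h) \<union> zbox (a + axis i h) (sides S h)"
    by blast
  show "zbox a (sides S h) \<inter> zbox (a + axis i h) (sides S h) = {}"
  proof (rule ccontr)
    assume "\<not> ?thesis"
    then obtain x where "x \<in> zbox a (sides S h)" "x \<in> zbox (a + axis i h) (sides S h)" by blast
    then have "x $ i < a $ i + h" "a $ i + h \<le> x $ i"
      using assms(1) by (auto simp: zbox_def sides_def * dest!: spec[of _ i])
    then show False by simp
  qed
qed

lemma card_zbox_shift: "card (zbox (a + b) l) = card (zbox (a :: int ^ 'n::finite) l)"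
  by (simp add: card_zbox)

lemma zbox_shift: "zbox (a + b) l = (\<lambda>x. x + b) ` zbox a l"
proof -
  have "x \<in> (\<lambda>x. x + b) ` zbox a l" if "x \<in> zbox (a + b) l" for x
    using that by (intro image_eqI[of _ _ "x - b"]) (auto simp: zbox_def algebra_simps)
  then show ?thesis by (auto simp: zbox_def)
qed

lemma finite_steps [simp]: "finite B \<Longrightarrow> finite (steps (B :: (int ^ 'n::finite) set))"
  by (rule finite_subset[of _ "B \<times> UNIV"]) (auto simp: steps_def)

text \<open>Induction on the set of doubled coordinates. As \<open>G\<close> is superadditive, the
  bounds for the two halves combine with the same constant, so each doubling only adds \<delta> to
  it and the constants never multiply. \<open>X\<close> is a region in which the moment assumption
  is available.\<close>

lemma zbox_doubling_induct:
  fixes F G :: "(int ^ 'n::finite) set \<Rightarrow> real" and \<Gamma> \<delta> :: real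
  assumes F: "\<And>S a i. i \<notin> S \<Longrightarrow> zbox a (sides (insert i S) h) \<subseteq> X \<Longrightarrow>
      F (zbox a (sides (insert i S) h)) \<le> F (zbox a (sides S h)) + F (zbox (a + axis i h) (sides S h))
        + \<delta> * G (zbox a (sides (insert i S) h))"
    and G: "\<And>A B. finite A \<Longrightarrow> finite B \<Longrightarrow> A \<inter> B = {} \<Longrightarrow> G A + G B \<le> G (A \<union> B)"
    and base: "\<And>a. zbox a (sides {} h) \<subseteq> X \<Longrightarrow> F (zbox a (sides {} h)) \<le> \<Gamma> * G (zbox a (sides {} h))"
    and "\<Gamma> \<ge> 0" "\<delta> \<ge> 0" "h > 0"
    and "zbox a (sides {} (2 * h)) \<subseteq> X"
  shows "F (zbox a (sides {} (2 * h))) \<le> (\<Gamma> + CARD('n) * \<delta>) * G (zbox a (sides {} (2 * h)))"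
proof -
  have "F (zbox a (sides S h)) \<le> (\<Gamma> + card S * \<delta>) * G (zbox a (sides S h))"
    if "zbox a (sides S h) \<subseteq> X" for a and S :: "'n set"
    using finite[of S] that
  proof (induction S arbitrary: a rule: finite_induct)
    case empty
    then show ?case using base by simp
  next
    case (insert i S)
    let ?B = "zbox a (sides (insert i S) h)"
    let ?B1 = "zbox a (sides S h)" let ?B2 = "zbox (a + axis i h) (sides S h)"
    let ?c = "\<Gamma> + card S * \<delta>"
    note half = zbox_half[OF insert.hyps(2) \<open>h > 0\<close>, of a]
    have "F ?B \<le> F ?B1 + F ?B2 + \<delta> * G ?B"
      by (rule F) (use insert in auto)
    also have "F ?B1 \<le> ?c * G ?B1" by (rule insert.IH) (use insert.prems half in auto)
    also have "F ?B2 \<le> ?c * G ?B2" by (rule insert.IH) (use insert.prems half in auto)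
    also have "?c * G ?B1 + ?c * G ?B2 = ?c * (G ?B1 + G ?B2)" by (simp add: algebra_simps)
    also have "\<dots> \<le> ?c * G ?B"
      unfolding half(1) by (intro mult_left_mono G) (use half assms in auto)
    finally show ?case using insert.hyps by (simp add: algebra_simps)
  qed
  from this[of a UNIV] show ?thesis
    using assms by (simp add: sides_UNIV)
qed

subsection \<open>The variance over a box\<close>

text \<open>For finite nonempty \<open>B\<close>, the unnormalised variance: the sum of squared
  deviations from the mean, expanded.\<close>

definition variance_on :: "('a \<Rightarrow> real) \<Rightarrow> 'a set \<Rightarrow> real" where
  "variance_on f B = (\<Sum>x\<in>B. (f x)\<^sup>2) - (sum f B)\<^sup>2 / card B"

text \<open>With \<open>n\<close> points in each half and sums \<open>a\<close>, \<open>b\<close>,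
  this is \<open>a^2 / n + b^2 / n - (a + b)^2 / (2 * n) = (b - a)^2 / (2 * n)\<close>; equal
  cardinalities produce the perfect square.\<close>

lemma variance_on_Un:
  assumes "finite A" "finite B" "A \<inter> B = {}" "card A = card B" "card A > 0"
  shows "variance_on f (A \<union> B) = variance_on f A + variance_on f B
     + (sum f B - sum f A)\<^sup>2 / card (A \<union> B)"
proof -
  define n where "n = real (card A)"
  have n: "n > 0" "real (card A) = n" "real (card B) = n" "real (card (A \<union> B)) = 2 * n"
    using assms by (auto simp: n_def card_Un_disjoint)
  show ?thesis
    using n(1) assms(1-3) unfolding variance_on_def n
    by (simp add: sum.union_disjoint field_simps power2_eq_square)
qed

text \<open>One half is the other translated by \<open>h\<close> in direction \<open>i\<close>.
  Telescoping along the \<open>h\<close> unit steps bounds the difference by \<open>h\<close> sums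
  of gradients, each over a translate of the first half.\<close>

lemma sum_diff_halves:
  fixes f :: "int ^ 'n::finite \<Rightarrow> real" and a :: "int ^ 'n"
  assumes "i \<notin> S" "h > 0"
  defines "B \<equiv> zbox a (sides (insert i S) h)"
  defines "Y \<equiv> {x \<in> B. x + axis i 1 \<in> B}"
  shows "\<bar>sum f (zbox (a + axis i h) (sides S h)) - sum f (zbox a (sides S h))\<bar>
    \<le> h * (\<Sum>x\<in>Y. \<bar>f (x + axis i 1) - f x\<bar>)"
proof -
  let ?A = "zbox a (sides S h)" and ?e = "\<lambda>j::nat. axis i (int j) :: int ^ 'n"
  have fin: "finite B" "finite Y" by (auto simp: B_def Y_def)
  have step: "axis i (int (Suc j)) = ?e j + axis i 1" for j
    by (simp add: axis_def vec_eq_iff)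
  have sum2: "sum f (zbox (a + axis i h) (sides S h)) = (\<Sum>x\<in>?A. f (x + ?e (nat h)))"
    unfolding zbox_shift using assms by (subst sum.reindex) (auto simp: inj_on_def)
  have "\<bar>f (x + ?e m) - f x\<bar> \<le> (\<Sum>j<m. \<bar>f (x + ?e j + axis i 1) - f (x + ?e j)\<bar>)" for x m
  proof (induction m)
    case 0
    have "axis i 0 = (0 :: int ^ 'n)" by (simp add: axis_def vec_eq_iff)
    then have "f (x + axis i 0) = f x" by (metis add.right_neutral)
    then show ?case by simp
  next
    case (Suc m)
    then show ?case by (simp only: step sum.lessThan_Suc add.assoc)
  qed
  note tel = this
  \<comment> \<open>For \<open>j < h\<close> both endpoints of the translated edges stay in the
    doubled box, so each of these sums is at most the sum over all edges of the box in direction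
    \<open>i\<close>.\<close>
  have inner: "(\<Sum>x\<in>?A. \<bar>f (x + ?e j + axis i 1) - f (x + ?e j)\<bar>)
      \<le> (\<Sum>x\<in>Y. \<bar>f (x + axis i 1) - f x\<bar>)" if "j < nat h" for j
  proof -
    have "(\<Sum>x\<in>?A. \<bar>f (x + ?e j + axis i 1) - f (x + ?e j)\<bar>)
        = (\<Sum>x\<in>(\<lambda>x. x + ?e j) ` ?A. \<bar>f (x + axis i 1) - f x\<bar>)"
      by (subst sum.reindex) (auto simp: inj_on_def)
    also have "(\<lambda>x. x + ?e j) ` ?A \<subseteq> Y"
    proof clarify
      fix x assume x: "x \<in> ?A"
      have mem: "a $ k \<le> x $ k" "x $ k < a $ k + (if k \<in> S then 2 * h else h)" for k
        using x by (auto simp: zbox_def sides_def)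
      have j: "int j < h" using that by simp
      have "x + ?e j \<in> B"
        unfolding B_def zbox_def mem_Collect_eq
      proof
        fix k show "a $ k \<le> (x + ?e j) $ k \<and> (x + ?e j) $ k < a $ k + sides (insert i S) h $ k"
          using mem[of k] j assms(1) by (cases "k = i") (auto simp: sides_def axis_def)
      qed
      moreover have "x + ?e j + axis i 1 \<in> B"
        unfolding B_def zbox_def mem_Collect_eq
      proof
        fix k show "a $ k \<le> (x + ?e j + axis i 1) $ k \<and> (x + ?e j + axis i 1) $ k < a $ k + sides (insert i S) h $ k"
          using mem[of k] j assms(1) by (cases "k = i") (auto simp: sides_def axis_def)
      qed
      ultimately show "x + ?e j \<in> Y" by (simp add: Y_def)
    qed
    then have "(\<Sum>x\<in>(\<lambda>x. x + ?e j) ` ?A. \<bar>f (x + axis i 1) - f x\<bar>)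
        \<le> (\<Sum>x\<in>Y. \<bar>f (x + axis i 1) - f x\<bar>)"
      by (intro sum_mono2 fin) auto
    finally show ?thesis .
  qed
  have "\<bar>sum f (zbox (a + axis i h) (sides S h)) - sum f ?A\<bar> \<le> (\<Sum>x\<in>?A. \<bar>f (x + ?e (nat h)) - f x\<bar>)"
    unfolding sum2 sum_subtractf[symmetric] by (rule sum_abs)
  also have "\<dots> \<le> (\<Sum>x\<in>?A. \<Sum>j<nat h. \<bar>f (x + ?e j + axis i 1) - f (x + ?e j)\<bar>)"
    by (intro sum_mono tel)
  also have "\<dots> = (\<Sum>j<nat h. \<Sum>x\<in>?A. \<bar>f (x + ?e j + axis i 1) - f (x + ?e j)\<bar>)"
    by (rule sum.swap)
  also have "\<dots> \<le> (\<Sum>j<nat h. \<Sum>x\<in>Y. \<bar>f (x + axis i 1) - f x\<bar>)"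
    by (intro sum_mono inner) simp
  finally show ?thesis using assms(2) by simp
qed

section \<open>Weighted energy, and the variance on cubes\<close>

definition energy :: "(int ^ 'n \<Rightarrow> real) \<Rightarrow> ((int ^ 'n) \<times> 'n \<Rightarrow> real) \<Rightarrow> ((int ^ 'n) \<times> 'n) set \<Rightarrow> real" where
  "energy f u Y = (\<Sum>(x, i)\<in>Y. (u (x, i) * \<bar>f (x + axis i 1) - f x\<bar>)\<^sup>2)"

lemma energy_nonneg: "energy f u Y \<ge> 0"
  unfolding energy_def by (intro sum_nonneg) auto

lemma energy_mono: "finite B \<Longrightarrow> A \<subseteq> B \<Longrightarrow> energy f u A \<le> energy f u B"
  unfolding energy_def by (intro sum_mono2) auto

text \<open>Edges inside \<open>A\<close> differ from edges inside \<open>B\<close>; edges joining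
  the two sets occur only on the right.\<close>

lemma energy_steps_Un:
  fixes A B :: "(int ^ 'n::finite) set"
  assumes "finite A" "finite B" "A \<inter> B = {}"
  shows "energy f u (steps A) + energy f u (steps B) \<le> energy f u (steps (A \<union> B))"
proof -
  have "energy f u (steps A) + energy f u (steps B) = energy f u (steps A \<union> steps B)"
    unfolding energy_def
    by (rule sum.union_disjoint[symmetric]) (use assms in simp, use assms in simp,
      use assms in \<open>auto simp: steps_def\<close>)
  also have "\<dots> \<le> energy f u (steps (A \<union> B))"
    by (rule energy_mono) (use assms in simp, auto simp: steps_def)
  finally show ?thesis .
qed

text \<open>Cauchy-Schwarz separates the gradient sum into the energy and the sum of
  \<open>(1 / u e)\<^sup>2\<close>, which \<open>mom\<close> bounds. Dividing by the cardinality
  \<open>n\<close> leaves the factor \<open>h^2 * n powr (- 2 * \<kappa>)\<close>, and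
  \<open>n\<close> is at least \<open>h ^ CARD('n)\<close>.\<close>

lemma variance_halving:
  fixes f :: "int ^ 'n::finite \<Rightarrow> real" and \<kappa> L :: real and k :: nat
  assumes "i \<notin> S" and h: "h = 2 ^ k" and u: "\<And>e. u e > 0" and \<kappa>: "0 \<le> \<kappa>" "2 * \<kappa> \<le> 1" and "L \<ge> 0"
    and mom: "\<And>Y. Y \<subseteq> steps X \<Longrightarrow> (\<Sum>e\<in>Y. (1 / u e)\<^sup>2) \<le> real (card Y) powr (1 - 2 * \<kappa>) * L"
    and X: "zbox a (sides (insert i S) h) \<subseteq> X"
  shows "variance_on f (zbox a (sides (insert i S) h)) \<le>
     variance_on f (zbox a (sides S h)) + variance_on f (zbox (a + axis i h) (sides S h))
     + 2 powr (2 * (1 - CARD('n) * \<kappa>) * k) * L * energy f u (steps (zbox a (sides (insert i S) h)))"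
proof -
  define B where "B = zbox a (sides (insert i S) h)"
  define Y where "Y = {x \<in> B. x + axis i 1 \<in> B}"
  define Z where "Z = (\<lambda>x. (x, i)) ` Y"
  define G where "G = energy f u (steps B)"
  define n where "n = real (card B)"
  let ?B1 = "zbox a (sides S h)" and ?B2 = "zbox (a + axis i h) (sides S h)"
  have h0: "h > 0" using h by simp
  note half = zbox_half[OF assms(1) h0, of a]
  have fin: "finite B" "finite Y" "finite Z" by (auto simp: B_def Y_def Z_def)
  have cardge: "nat h ^ CARD('n) \<le> card (zbox b (sides T h))" for b and T :: "'n set"
    by (rule card_zbox_sides_ge[OF h0])
  have hpow: "nat h ^ CARD('n) > 0" using h0 by simp
  have n: "n \<ge> real_of_int h ^ CARD('n)" "n > 0"
    using cardge[of a "insert i S"] hpow h0 unfolding n_def B_def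
    by (metis of_nat_le_iff of_nat_power of_nat_nat less_imp_le)
      (use cardge[of a "insert i S"] hpow in linarith)
  \<comment> \<open>\<open>Z\<close> has edges in the single direction \<open>i\<close>, hence at
    most one per point of the box. As \<open>1 - 2 * \<kappa>\<close> is nonnegative,
    \<open>card Z\<close> may then be replaced by \<open>n\<close> in the moment bound.\<close>
  have cY: "card Z \<le> card B"
    unfolding Z_def by (rule order.trans[OF card_image_le[OF fin(2)]], rule card_mono[OF fin(1)])
      (auto simp: Y_def)
  have Zsub: "Z \<subseteq> steps B" "Z \<subseteq> steps X"
    using X by (auto simp: Z_def Y_def steps_def B_def)
  have "(\<Sum>x\<in>Y. \<bar>f (x + axis i 1) - f x\<bar>)\<^sup>2
      = (\<Sum>e\<in>Z. (u e * \<bar>f (fst e + axis (snd e) 1) - f (fst e)\<bar>) * (1 / u e))\<^sup>2"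
    unfolding Z_def by (subst sum.reindex) (use u in \<open>auto simp: inj_on_def less_imp_neq[symmetric]\<close>)
  also have "\<dots> \<le> energy f u Z * (\<Sum>e\<in>Z. (1 / u e)\<^sup>2)"
    unfolding energy_def case_prod_unfold by (rule order.trans[OF Cauchy_Schwarz_ineq_sum]) simp
  also have "\<dots> \<le> G * (n powr (1 - 2 * \<kappa>) * L)"
  proof (rule mult_mono)
    show "energy f u Z \<le> G"
      unfolding G_def by (rule energy_mono[OF _ Zsub(1)]) (use fin in auto)
    have "(\<Sum>e\<in>Z. (1 / u e)\<^sup>2) \<le> real (card Z) powr (1 - 2 * \<kappa>) * L"
      by (rule mom[OF Zsub(2)])
    also have "\<dots> \<le> n powr (1 - 2 * \<kappa>) * L"
      unfolding n_def by (intro mult_right_mono powr_mono2) (use cY \<kappa> \<open>L \<ge> 0\<close> in auto)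
    finally show "(\<Sum>e\<in>Z. (1 / u e)\<^sup>2) \<le> n powr (1 - 2 * \<kappa>) * L" .
  qed (auto simp: G_def energy_nonneg intro: sum_nonneg)
  finally have CS: "(\<Sum>x\<in>Y. \<bar>f (x + axis i 1) - f x\<bar>)\<^sup>2 \<le> G * (n powr (1 - 2 * \<kappa>) * L)" .
  have "\<bar>sum f ?B2 - sum f ?B1\<bar> \<le> h * (\<Sum>x\<in>Y. \<bar>f (x + axis i 1) - f x\<bar>)"
    unfolding Y_def B_def by (rule sum_diff_halves[OF assms(1) h0])
  then have "(sum f ?B2 - sum f ?B1)\<^sup>2 \<le> (h * (\<Sum>x\<in>Y. \<bar>f (x + axis i 1) - f x\<bar>))\<^sup>2"
    by (rule abs_le_square_iff[THEN iffD1, OF order.trans]) simp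
  also have "\<dots> = (real_of_int h)\<^sup>2 * (\<Sum>x\<in>Y. \<bar>f (x + axis i 1) - f x\<bar>)\<^sup>2"
    by (simp add: power_mult_distrib)
  also have "\<dots> \<le> (real_of_int h)\<^sup>2 * (G * (n powr (1 - 2 * \<kappa>) * L))"
    by (intro mult_left_mono CS) auto
  finally have "(sum f ?B2 - sum f ?B1)\<^sup>2 / n \<le> (real_of_int h)\<^sup>2 * (G * (n powr (1 - 2 * \<kappa>) * L)) / n"
    using n by (intro divide_right_mono) auto
  also have "\<dots> = (real_of_int h)\<^sup>2 * n powr (- (2 * \<kappa>)) * L * G"
    using n by (simp add: powr_diff powr_minus field_simps)
  also have "\<dots> \<le> (real_of_int h)\<^sup>2 * (real_of_int h ^ CARD('n)) powr (- (2 * \<kappa>)) * L * G"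
    using n \<kappa> h0 \<open>L \<ge> 0\<close>
    by (intro mult_right_mono mult_left_mono powr_mono2') (auto simp: G_def energy_nonneg)
  also have "(real_of_int h)\<^sup>2 * (real_of_int h ^ CARD('n)) powr (- (2 * \<kappa>))
     = 2 powr (2 * (1 - CARD('n) * \<kappa>) * k)"
    by (simp add: h powr_powr power_mult[symmetric] flip: powr_realpow powr_add)
       (simp add: algebra_simps)
  finally have main: "(sum f ?B2 - sum f ?B1)\<^sup>2 / n \<le> 2 powr (2 * (1 - CARD('n) * \<kappa>) * k) * L * G" .
  have "variance_on f B = variance_on f ?B1 + variance_on f ?B2 + (sum f ?B2 - sum f ?B1)\<^sup>2 / n"
    unfolding B_def n_def half(1)
    using cardge[of a S] hpow half(2) by (intro variance_on_Un) (auto simp: card_zbox_shift)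
  with main show ?thesis unfolding B_def G_def by simp
qed

text \<open>Single points have variance 0, and passing from side \<open>2 ^ j\<close> to
  \<open>2 ^ Suc j\<close> takes \<open>CARD('n)\<close> halvings, each with coefficient
  \<open>2 powr (2 * \<sigma> * j)\<close>. The constant is the exact sum of this geometric series,
  which grows because \<sigma> is positive.\<close>

lemma variance_cube:
  fixes f :: "int ^ 'n::finite \<Rightarrow> real" and \<kappa> \<sigma> L :: real and k :: nat
  defines "\<sigma> \<equiv> 1 - CARD('n) * \<kappa>"
  assumes u: "\<And>e. u e > 0" and \<kappa>: "0 \<le> \<kappa>" "2 * \<kappa> \<le> 1" "\<sigma> > 0" and "L \<ge> 0"
    and mom: "\<And>Y. Y \<subseteq> steps X \<Longrightarrow> (\<Sum>e\<in>Y. (1 / u e)\<^sup>2) \<le> real (card Y) powr (1 - 2 * \<kappa>) * L"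
    and X: "zbox a (sides {} (2 ^ k)) \<subseteq> X"
  shows "variance_on f (zbox a (sides {} (2 ^ k))) \<le>
     CARD('n) / (2 powr (2 * \<sigma>) - 1) * (2 powr (2 * \<sigma> * k) - 1)
       * (L * energy f u (steps (zbox a (sides {} (2 ^ k)))))"
  using X
proof (induction k arbitrary: a)
  case 0
  have "card (zbox a (sides {} 1)) = 1" by (simp add: card_zbox_cube)
  then obtain x where "zbox a (sides {} 1) = {x}" by (rule card_1_singletonE)
  then show ?case by (simp add: variance_on_def)
next
  case (Suc k)
  let ?b = "2 powr (2 * \<sigma>)"
  have b: "?b > 1" using \<kappa> by simp
  have bk: "2 powr (2 * \<sigma> * k) \<ge> 1" using \<kappa> by (intro ge_one_powr_ge_zero) auto
  have "variance_on f (zbox a (sides {} (2 * 2 ^ k))) \<le>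
    (CARD('n) / (?b - 1) * (2 powr (2 * \<sigma> * k) - 1) + CARD('n) * 2 powr (2 * \<sigma> * k))
    * (L * energy f u (steps (zbox a (sides {} (2 * 2 ^ k)))))"
  proof (rule zbox_doubling_induct[where X = X and G = "\<lambda>B. L * energy f u (steps B)"])
    fix S :: "'n set" and a :: "int ^ 'n" and i
    assume "i \<notin> S" and X: "zbox a (sides (insert i S) (2 ^ k)) \<subseteq> X"
    show "variance_on f (zbox a (sides (insert i S) (2 ^ k))) \<le>
      variance_on f (zbox a (sides S (2 ^ k))) + variance_on f (zbox (a + axis i (2 ^ k)) (sides S (2 ^ k)))
      + 2 powr (2 * \<sigma> * k) * (L * energy f u (steps (zbox a (sides (insert i S) (2 ^ k)))))"
      using variance_halving[OF \<open>i \<notin> S\<close> refl u \<kappa>(1,2) \<open>L \<ge> 0\<close> mom X] by (simp add: \<sigma>_def mult_ac)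
  next
    fix A B :: "(int ^ 'n) set" assume "finite A" "finite B" "A \<inter> B = {}"
    then have "L * (energy f u (steps A) + energy f u (steps B)) \<le> L * energy f u (steps (A \<union> B))"
      by (intro mult_left_mono energy_steps_Un \<open>L \<ge> 0\<close>)
    then show "L * energy f u (steps A) + L * energy f u (steps B) \<le> L * energy f u (steps (A \<union> B))"
      by (simp add: algebra_simps)
  qed (use Suc b bk in auto)
  also have "CARD('n) / (?b - 1) * (2 powr (2 * \<sigma> * k) - 1) + CARD('n) * 2 powr (2 * \<sigma> * k)
      = CARD('n) / (?b - 1) * (2 powr (2 * \<sigma> * Suc k) - 1)"
  proof -
    have "c / (b - 1) * (x - 1) + c * x = c / (b - 1) * (b * x - 1)" if "b > 1" for b c x :: real
      using that by (simp add: divide_simps) (simp add: algebra_simps)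
    from this[OF b] show ?thesis by (simp add: distrib_left powr_add)
  qed
  finally show ?case by simp
qed

text \<open>On a cube of side \<open>2 ^ K\<close> the sum of squares is the variance plus the
  squared sum of \<open>f\<close> divided by the cardinality. A larger cube is a union of such cubes
  and the right-hand side is superadditive, so the estimate is inherited without loss.\<close>

lemma nash_cube:
  fixes f :: "int ^ 'n::finite \<Rightarrow> real" and \<kappa> \<sigma> L :: real and k :: nat
  defines "\<sigma> \<equiv> 1 - CARD('n) * \<kappa>"
  assumes u: "\<And>e. u e > 0" and \<kappa>: "0 \<le> \<kappa>" "2 * \<kappa> \<le> 1" "\<sigma> > 0" and "L \<ge> 0"
    and mom: "\<And>Y. Y \<subseteq> steps X \<Longrightarrow> (\<Sum>e\<in>Y. (1 / u e)\<^sup>2) \<le> real (card Y) powr (1 - 2 * \<kappa>) * L"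
    and "K \<le> k" and X: "zbox a (sides {} (2 ^ k)) \<subseteq> X"
  shows "(\<Sum>x\<in>zbox a (sides {} (2 ^ k)). (f x)\<^sup>2) \<le>
     CARD('n) / (2 powr (2 * \<sigma>) - 1) * 2 powr (2 * \<sigma> * K)
       * (L * energy f u (steps (zbox a (sides {} (2 ^ k)))))
     + 2 powr (- real (CARD('n) * K)) * (\<Sum>x\<in>zbox a (sides {} (2 ^ k)). \<bar>f x\<bar>)\<^sup>2"
  using \<open>K \<le> k\<close> X
proof (induction k arbitrary: a rule: dec_induct)
  case base
  let ?Q = "zbox a (sides {} (2 ^ K))"
  have b: "2 powr (2 * \<sigma>) > 1" using \<kappa> by simp
  have c: "real (card ?Q) = 2 powr real (CARD('n) * K)"
    by (simp add: card_zbox_cube powr_realpow power_mult mult.commute flip: nat_power_eq)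
      (simp add: power_mult[symmetric] powr_realpow flip: of_nat_mult)
  have "variance_on f ?Q \<le> CARD('n) / (2 powr (2 * \<sigma>) - 1) * (2 powr (2 * \<sigma> * K) - 1)
       * (L * energy f u (steps ?Q))"
    unfolding \<sigma>_def by (rule variance_cube) (use assms base in auto)
  also have "\<dots> \<le> CARD('n) / (2 powr (2 * \<sigma>) - 1) * 2 powr (2 * \<sigma> * K) * (L * energy f u (steps ?Q))"
    using b \<open>L \<ge> 0\<close> by (intro mult_right_mono mult_left_mono) (auto simp: energy_nonneg)
  finally have "variance_on f ?Q \<le> \<dots>" .
  moreover have "(\<Sum>x\<in>?Q. (f x)\<^sup>2) = variance_on f ?Q + 2 powr (- real (CARD('n) * K)) * (sum f ?Q)\<^sup>2"
    by (simp add: variance_on_def c powr_minus divide_inverse mult.commute)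
  moreover have "(sum f ?Q)\<^sup>2 \<le> (\<Sum>x\<in>?Q. \<bar>f x\<bar>)\<^sup>2"
    by (rule abs_le_square_iff[THEN iffD1]) (simp add: sum_nonneg)
  ultimately show ?case
    by (smt (verit) mult_left_mono powr_ge_zero)
next
  case (step k)
  let ?C = "CARD('n) / (2 powr (2 * \<sigma>) - 1) * 2 powr (2 * \<sigma> * K)"
  let ?G = "\<lambda>B. ?C * (L * energy f u (steps B)) + 2 powr (- real (CARD('n) * K)) * (\<Sum>x\<in>B. \<bar>f x\<bar>)\<^sup>2"
  have "2 powr (2 * \<sigma>) > 1" using \<kappa> by simp
  then have C: "?C \<ge> 0" by simp
  \<comment> \<open>Doubling with \<Gamma> = 1 and \<delta> = 0: sums of squares are additive, while
    the energy and the square of a nonnegative sum are superadditive.\<close>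
  have "(\<Sum>x\<in>zbox a (sides {} (2 * 2 ^ k)). (f x)\<^sup>2) \<le> (1 + real CARD('n) * 0) * ?G (zbox a (sides {} (2 * 2 ^ k)))"
  proof (rule zbox_doubling_induct[where X = X and F = "\<lambda>B. \<Sum>x\<in>B. (f x)\<^sup>2" and G = ?G])
    fix S :: "'n set" and a :: "int ^ 'n" and i assume "i \<notin> S"
    then show "(\<Sum>x\<in>zbox a (sides (insert i S) (2 ^ k)). (f x)\<^sup>2)
        \<le> (\<Sum>x\<in>zbox a (sides S (2 ^ k)). (f x)\<^sup>2)
          + (\<Sum>x\<in>zbox (a + axis i (2 ^ k)) (sides S (2 ^ k)). (f x)\<^sup>2)
          + 0 * ?G (zbox a (sides (insert i S) (2 ^ k)))"
      using zbox_half[of i S "2 ^ k" a] by (simp add: sum.union_disjoint)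
  next
    fix A B :: "(int ^ 'n) set" assume AB: "finite A" "finite B" "A \<inter> B = {}"
    have "?C * (L * energy f u (steps A)) + ?C * (L * energy f u (steps B))
        \<le> ?C * (L * energy f u (steps (A \<union> B)))"
      unfolding distrib_left[symmetric] by (intro mult_left_mono energy_steps_Un AB \<open>L \<ge> 0\<close> C)
    moreover have "(\<Sum>x\<in>A. \<bar>f x\<bar>)\<^sup>2 + (\<Sum>x\<in>B. \<bar>f x\<bar>)\<^sup>2 \<le> (\<Sum>x\<in>A \<union> B. \<bar>f x\<bar>)\<^sup>2"
      using AB by (simp add: sum.union_disjoint power2_sum sum_nonneg)
    then have "2 powr (- real (CARD('n) * K)) * (\<Sum>x\<in>A. \<bar>f x\<bar>)\<^sup>2 + 2 powr (- real (CARD('n) * K)) * (\<Sum>x\<in>B. \<bar>f x\<bar>)\<^sup>2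
      \<le> 2 powr (- real (CARD('n) * K)) * (\<Sum>x\<in>A \<union> B. \<bar>f x\<bar>)\<^sup>2"
      unfolding distrib_left[symmetric] by (intro mult_left_mono) auto
    ultimately show "?G A + ?G B \<le> ?G (A \<union> B)" by linarith
  qed (use step in auto)
  then show ?case by simp
qed

subsection \<open>Bounds at a pair of scales\<close>

text \<open>Half-open, so that the side is the power of two \<open>2 ^ Suc J\<close> and repeated
  halving applies.\<close>

definition dyadic_box :: "nat \<Rightarrow> (int ^ 'n) set" where
  "dyadic_box J = zbox (\<chi> i. - (2 ^ J)) (sides {} (2 ^ Suc J))"

lemma finite_dyadic_box [simp]: "finite (dyadic_box J :: (int ^ 'n::finite) set)"
  by (simp add: dyadic_box_def)

lemma card_dyadic_box: "real (card (dyadic_box J :: (int ^ 'n::finite) set)) = 2 powr (CARD('n) * (real J + 1))"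
proof -
  have "card (dyadic_box J :: (int ^ 'n::finite) set) = (2 ^ Suc J) ^ CARD('n)"
    by (simp add: dyadic_box_def card_zbox_cube nat_mult_distrib nat_power_eq)
  also have "real \<dots> = 2 powr real (Suc J * CARD('n))"
    by (simp only: powr_realpow power_mult) simp
  finally show ?thesis by (simp add: algebra_simps)
qed

lemma mem_dyadic_box: "x \<in> dyadic_box J \<longleftrightarrow> (\<forall>i. - (2 ^ J) \<le> x $ i \<and> x $ i < 2 ^ J)"
  by (simp add: dyadic_box_def zbox_def sides_def)

lemma dyadic_box_mono: "I \<le> J \<Longrightarrow> dyadic_box I \<subseteq> dyadic_box J"
proof
  fix x :: "int ^ 'n" assume "I \<le> J" "x \<in> dyadic_box I"
  moreover have "(2::int) ^ I \<le> 2 ^ J" using \<open>I \<le> J\<close> by (simp add: power_increasing)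
  ultimately show "x \<in> dyadic_box J" unfolding mem_dyadic_box by (meson le_minus_iff neg_le_iff_le order.trans less_le_trans)
qed

lemma znorm_star_ge_outside:
  assumes "x \<notin> dyadic_box J"
  shows "znorm_star x \<ge> 2 powr J"
proof -
  obtain i where "\<bar>x $ i\<bar> \<ge> 2 ^ J" using assms by (auto simp: mem_dyadic_box abs_if not_le not_less) (smt (verit))+
  then have "\<bar>real_of_int (x $ i)\<bar> \<ge> 2 ^ J"
    by (metis of_int_abs of_int_le_iff of_int_numeral of_int_power)
  also have "\<bar>real_of_int (x $ i)\<bar> \<le> znorm x"
    unfolding znorm_def using component_le_norm_cart[of "\<chi> i. real_of_int (x $ i)" i] by simp
  finally show ?thesis by (simp add: znorm_star_def powr_realpow)
qed

text \<open>Here \<open>\<kappa>\<close> is \<open>1 / q\<close>, so that \<open>q = \<infinity>\<close> is the case \<open>\<kappa> = 0\<close>, and \<open>M\<close> is \<open>\<M>\<^sub>q\<close> up to a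
  constant factor; the moment assumption is its form after Hoelder's inequality.\<close>

locale anchored_weight =
  fixes f :: "int ^ 'n::finite \<Rightarrow> real" and u :: "(int ^ 'n) \<times> 'n \<Rightarrow> real" and d \<kappa> M E :: real
  assumes u_pos: "u e > 0"
    and card_UNIV: "real CARD('n) = d" and dim: "d \<ge> 2"
    and \<kappa>: "0 \<le> \<kappa>" "d * \<kappa> < 1"
    and M_nonneg: "M \<ge> 0" and E_nonneg: "E \<ge> 0"
    and moment: "Y \<subseteq> steps (dyadic_box J) \<Longrightarrow>
      (\<Sum>e\<in>Y. (1 / u e)\<^sup>2) \<le> real (card Y) powr (1 - 2 * \<kappa>) * (M * 2 powr (d * \<kappa> * J))\<^sup>2"
    and energy_le: "finite Y \<Longrightarrow> energy f u Y \<le> E\<^sup>2"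
begin

definition \<sigma> :: real where "\<sigma> = 1 - d * \<kappa>"

definition c\<^sub>1 :: real where "c\<^sub>1 = d / (2 powr (2 * \<sigma>) - 1)"

lemma \<sigma>_pos: "\<sigma> > 0" and \<kappa>_le_half: "2 * \<kappa> \<le> 1"
proof -
  show "\<sigma> > 0" using \<kappa> by (simp add: \<sigma>_def)
  have "2 * \<kappa> \<le> d * \<kappa>" using dim \<kappa> by (intro mult_right_mono) auto
  then show "2 * \<kappa> \<le> 1" using \<kappa> by linarith
qed

lemma c\<^sub>1_pos: "c\<^sub>1 > 0"
  using \<sigma>_pos dim by (simp add: c\<^sub>1_def)

text \<open>The moment is controlled only on boxes around the origin. A cube of side
  \<open>2 ^ K\<close> elsewhere in the large box has to use the moment of the whole box, which
  costs \<open>2 powr (d * \<kappa> * J)\<close>, while averaging at scale \<open>K\<close> costs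
  \<open>2 powr (\<sigma> * K)\<close>.\<close>

lemma dyadic_box_bound:
  assumes "K \<le> J"
  shows "(\<Sum>x\<in>dyadic_box J. (f x)\<^sup>2) \<le> c\<^sub>1 * (2 powr (\<sigma> * K + d * \<kappa> * J) * (M * E))\<^sup>2
     + 2 powr (- d * K) * (\<Sum>x\<in>dyadic_box J. \<bar>f x\<bar>)\<^sup>2"
proof -
  let ?L = "(M * 2 powr (d * \<kappa> * J))\<^sup>2"
  have "(\<Sum>x\<in>dyadic_box J. (f x)\<^sup>2) \<le> c\<^sub>1 * 2 powr (2 * \<sigma> * K) * (?L * energy f u (steps (dyadic_box J)))
     + 2 powr (- real (CARD('n) * K)) * (\<Sum>x\<in>dyadic_box J. \<bar>f x\<bar>)\<^sup>2"
    using nash_cube[of u \<kappa> ?L "dyadic_box J" K "Suc J" "\<chi> i. - (2 ^ J)" f]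
      assms u_pos \<kappa> \<sigma>_pos \<kappa>_le_half moment
    by (simp add: c\<^sub>1_def \<sigma>_def dyadic_box_def card_UNIV)
  also have "\<dots> \<le> c\<^sub>1 * 2 powr (2 * \<sigma> * K) * (?L * E\<^sup>2)
     + 2 powr (- real (CARD('n) * K)) * (\<Sum>x\<in>dyadic_box J. \<bar>f x\<bar>)\<^sup>2"
    using c\<^sub>1_pos by (intro add_right_mono mult_left_mono energy_le) auto
  also have "c\<^sub>1 * 2 powr (2 * \<sigma> * K) * (?L * E\<^sup>2) = c\<^sub>1 * (2 powr (\<sigma> * K + d * \<kappa> * J) * (M * E))\<^sup>2"
    by (simp add: power2_eq_square powr_add mult_ac flip: powr_add) (simp add: powr_add[symmetric] algebra_simps)
  finally show ?thesis by (simp add: card_UNIV)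
qed

end

section \<open>Elementary tools for choosing scales\<close>

lemma dyadic_scale:
  fixes R :: real assumes "R \<ge> 1"
  obtains J :: nat where "2 powr J \<le> R" "R < 2 * 2 powr J"
proof -
  define J where "J = nat \<lfloor>log 2 R\<rfloor>"
  have "log 2 R \<ge> 0" using assms by simp
  then have J: "real J \<le> log 2 R" "log 2 R < real J + 1" unfolding J_def by linarith+
  have "2 powr log 2 R = R" using assms by (simp add: powr_log_cancel)
  then have "2 powr J \<le> R" "R < 2 powr (real J + 1)"
    using powr_mono[OF J(1), of 2] powr_less_mono[OF J(2), of 2] by auto
  then show ?thesis by (intro that) (auto simp: powr_add)
qed

lemma self_le_mult:
  fixes x :: real shows "1 \<le> c \<Longrightarrow> 0 \<le> x \<Longrightarrow> x \<le> c * x"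
  using mult_right_mono[of 1 c x] by simp

text \<open>The smaller of \<open>S\<close> and \<open>T\<close> is at most any weighted geometric
  mean of the two.\<close>

lemma square_bound_interpolate:
  fixes F c S T t :: real
  assumes "F \<le> c * S\<^sup>2" "F \<le> c * T\<^sup>2" "S > 0" "T > 0" "c \<ge> 0" "0 \<le> t" "t \<le> 1"
  shows "F \<le> c * (S powr (1 - t) * T powr t)\<^sup>2"
proof -
  let ?m = "min S T"
  have "?m = ?m powr (1 - t) * ?m powr t" using assms by (simp flip: powr_add)
  also have "\<dots> \<le> S powr (1 - t) * T powr t"
    using assms by (intro mult_mono powr_mono2) auto
  finally have "?m\<^sup>2 \<le> (S powr (1 - t) * T powr t)\<^sup>2" using assms by (intro power_mono) auto
  moreover have "F \<le> c * ?m\<^sup>2" using assms by (simp add: min_def)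
  ultimately show ?thesis using \<open>c \<ge> 0\<close> by (meson mult_left_mono order.trans)
qed

lemma finite_subset_dyadic_box:
  fixes S :: "(int ^ 'n::finite) set"
  assumes S: "finite S"
  obtains J where "S \<subseteq> dyadic_box J"
proof -
  define m where "m = Max (insert 0 (\<Union>x\<in>S. range (\<lambda>i. \<bar>x $ i\<bar>)))"
  have m: "\<bar>x $ i\<bar> \<le> m" if "x \<in> S" for x i
    unfolding m_def using that S by (intro Max_ge) auto
  have "m < 2 ^ nat m" using of_nat_less_two_power[of "nat m", where 'a = int] by linarith
  then have "S \<subseteq> dyadic_box (nat m)" using m unfolding mem_dyadic_box subset_iff by (smt (verit))
  then show ?thesis by (rule that)
qed

section \<open>From dyadic boxes to arbitrary finite sums and real scales\<close>

context anchored_weight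
begin

text \<open>One constant for all scale bounds: \<open>2 * c\<^sub>1\<close> and the last summand
  carry the one-scale bound after absorption; \<open>2 powr d\<close> and \<open>2 powr p\<close>
  pay for rounding \<rho> and \<open>R\<close> down to powers of two.\<close>

definition c\<^sub>2 :: "real \<Rightarrow> real" where
  "c\<^sub>2 p = 2 * c\<^sub>1 + 2 powr d + 2 * 2 powr p * (1 + 2 powr (1 + d + 3 * p))"

text \<open>Finite partial sums stand in for the norm, here and in \<open>sum_bound\<close>, so that
  no summability is presupposed.\<close>

definition weight_bound :: "real \<Rightarrow> real \<Rightarrow> bool" where
  "weight_bound p W \<longleftrightarrow> (\<forall>S. finite S \<longrightarrow> (\<Sum>x\<in>S. znorm_star x powr p * (f x)\<^sup>2) \<le> W\<^sup>2)"

definition sum_bound :: "real \<Rightarrow> bool" where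
  "sum_bound N \<longleftrightarrow> (\<forall>S. finite S \<longrightarrow> (\<Sum>x\<in>S. \<bar>f x\<bar>) \<le> N)"

lemma c\<^sub>2_ge: "c\<^sub>2 p \<ge> c\<^sub>1" "c\<^sub>2 p \<ge> 1" "c\<^sub>2 p \<ge> 2 powr d" "c\<^sub>2 p \<ge> 2 powr p"
    "c\<^sub>2 p \<ge> 2 * c\<^sub>1" "c\<^sub>2 p \<ge> 2 * 2 powr p * (1 + 2 powr (1 + d + 3 * p))"
proof -
  define x y z where "x = 2 powr d" and "y = 2 powr p" and "z = y * 2 powr (1 + d + 3 * p)"
  have "x \<ge> 1" "y \<ge> 0" "z \<ge> 0"
    using dim by (auto simp: x_def y_def z_def intro: ge_one_powr_ge_zero)
  moreover have "c\<^sub>2 p = 2 * c\<^sub>1 + x + 2 * y + 2 * z" "2 * 2 powr p * (1 + 2 powr (1 + d + 3 * p)) = 2 * y + 2 * z"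
    by (simp_all add: c\<^sub>2_def x_def y_def z_def algebra_simps)
  ultimately show "c\<^sub>2 p \<ge> c\<^sub>1" "c\<^sub>2 p \<ge> 1" "c\<^sub>2 p \<ge> 2 powr d" "c\<^sub>2 p \<ge> 2 powr p"
    "c\<^sub>2 p \<ge> 2 * c\<^sub>1" "c\<^sub>2 p \<ge> 2 * 2 powr p * (1 + 2 powr (1 + d + 3 * p))"
    unfolding x_def[symmetric] y_def[symmetric] using c\<^sub>1_pos by linarith+
qed

lemma tail_le:
  assumes "weight_bound p W" "p \<ge> 0" "finite S" "S \<inter> dyadic_box J = {}"
  shows "(\<Sum>x\<in>S. (f x)\<^sup>2) \<le> 2 powr (- p * J) * W\<^sup>2"
proof -
  have "(\<Sum>x\<in>S. (f x)\<^sup>2) \<le> (\<Sum>x\<in>S. 2 powr (- p * J) * (znorm_star x powr p * (f x)\<^sup>2))"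
  proof (rule sum_mono)
    fix x assume "x \<in> S"
    then have "x \<notin> dyadic_box J" using assms(4) by blast
    then have "2 powr J \<le> znorm_star x" by (rule znorm_star_ge_outside)
    then have "(2 powr J) powr p \<le> znorm_star x powr p" using assms(2) by (intro powr_mono2) auto
    then have "2 powr (- p * J) * (2 powr J) powr p * (f x)\<^sup>2 \<le> 2 powr (- p * J) * znorm_star x powr p * (f x)\<^sup>2"
      by (intro mult_right_mono mult_left_mono) auto
    also have "2 powr (- p * J) * (2 powr J) powr p = 1"
      by (simp add: powr_powr flip: powr_add)
    finally show "(f x)\<^sup>2 \<le> 2 powr (- p * J) * (znorm_star x powr p * (f x)\<^sup>2)" by (simp add: mult_ac)
  qed
  also have "\<dots> \<le> 2 powr (- p * J) * W\<^sup>2"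
    unfolding sum_distrib_left[symmetric] using assms by (intro mult_left_mono) (auto simp: weight_bound_def)
  finally show ?thesis .
qed

lemma sum_le_weight:
  assumes "weight_bound p W" "p \<ge> 0" "finite S"
  shows "(\<Sum>x\<in>S. (f x)\<^sup>2) \<le> W\<^sup>2"
proof -
  have "(\<Sum>x\<in>S. (f x)\<^sup>2) \<le> (\<Sum>x\<in>S. znorm_star x powr p * (f x)\<^sup>2)"
  proof (rule sum_mono)
    fix x :: "int ^ 'n"
    have "znorm_star x powr p \<ge> 1" using assms(2) by (intro ge_one_powr_ge_zero) (auto simp: znorm_star_def)
    then show "(f x)\<^sup>2 \<le> znorm_star x powr p * (f x)\<^sup>2" by (simp add: self_le_mult)
  qed
  also have "\<dots> \<le> W\<^sup>2" using assms by (auto simp: weight_bound_def)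
  finally show ?thesis .
qed

lemma sum_le_dyadic:
  assumes "weight_bound p W" "p \<ge> 0" "finite S"
  shows "(\<Sum>x\<in>S. (f x)\<^sup>2) \<le> (\<Sum>x\<in>dyadic_box J. (f x)\<^sup>2) + 2 powr (- p * J) * W\<^sup>2"
proof -
  have "(\<Sum>x\<in>S. (f x)\<^sup>2) = (\<Sum>x\<in>S \<inter> dyadic_box J. (f x)\<^sup>2) + (\<Sum>x\<in>S - dyadic_box J. (f x)\<^sup>2)"
    using sum.Int_Diff[OF assms(3)] .
  also have "\<dots> \<le> (\<Sum>x\<in>dyadic_box J. (f x)\<^sup>2) + 2 powr (- p * J) * W\<^sup>2"
    using assms by (intro add_mono sum_mono2 tail_le) auto
  finally show ?thesis .
qed

text \<open>The box bound with both scales equal to \<open>J\<close> leaves an l1 term. It is split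
  at a box smaller by the factor 8: inside, Cauchy-Schwarz gives a small multiple of the total sum
  of squares, which is absorbed on the left; outside, the weight controls the tail. Thus no l1 norm
  remains.\<close>

lemma dyadic_moment_bound:
  fixes p :: real and J :: nat
  assumes W: "weight_bound p W" and p: "p \<ge> 0" and S: "finite S"
  shows "(\<Sum>x\<in>S. (f x)\<^sup>2) \<le> 2 * c\<^sub>1 * (2 powr J * (M * E))\<^sup>2
    + 2 * (1 + 2 powr (1 + d + 3 * p)) * (2 powr (- p * J) * W\<^sup>2)"
proof (cases "J \<ge> 3")
  case False
  have "(\<Sum>x\<in>S. (f x)\<^sup>2) \<le> W\<^sup>2" by (rule sum_le_weight[OF W p S])
  \<comment> \<open>For \<open>J < 3\<close> the factor \<open>2 powr (3 * p)\<close> compensates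
    \<open>2 powr (- p * J)\<close>, and the weight bound alone suffices.\<close>
  also have "\<dots> \<le> 2 powr (1 + d + 3 * p) * 2 powr (- p * J) * W\<^sup>2"
  proof -
    have "p * J \<le> p * 3" using False p by (intro mult_left_mono) auto
    then have "1 \<le> (2::real) powr (1 + d + 3 * p + - p * J)"
      using p dim by (intro ge_one_powr_ge_zero) auto
    then show ?thesis unfolding powr_add[symmetric] by (intro self_le_mult) auto
  qed
  also have "\<dots> \<le> 2 * c\<^sub>1 * (2 powr J * (M * E))\<^sup>2
      + 2 * (1 + 2 powr (1 + d + 3 * p)) * (2 powr (- p * J) * W\<^sup>2)"
  proof -
    define A B V where "A = (2::real) powr (1 + d + 3 * p)" and "B = 2 powr (- p * J) * W\<^sup>2"
      and "V = 2 * c\<^sub>1 * (2 powr J * (M * E))\<^sup>2"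
    have "V \<ge> 0" "B \<ge> 0" "A * B \<ge> 0" using c\<^sub>1_pos by (simp_all add: V_def B_def A_def)
    then have "A * B \<le> V + 2 * (1 + A) * B" by (simp add: algebra_simps)
    then show ?thesis unfolding A_def B_def V_def by (simp add: mult.assoc)
  qed
  finally show ?thesis .
next
  case True
  \<comment> \<open>With the gap 3, the inner term normalised by \<open>2 powr (- d * J)\<close>
    becomes \<open>2 * 2 powr (- 2 * d)\<close> times the total; the leading 2 comes from squaring a
    sum of two terms. This is at most 1/2 since \<open>d \<ge> 2\<close>.\<close>
  define I where "I = J - 3"
  have J: "J = I + 3" using True by (simp add: I_def)
  \<comment> \<open>The total sum will occur on both sides. Absorbing half of it is legitimate
    because the weight bound makes it finite.\<close>
  define F where "F = (\<Sum>\<^sub>\<infinity>x. (f x)\<^sup>2)"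
  have summ: "(\<lambda>x. (f x)\<^sup>2) summable_on UNIV"
    by (rule nonneg_bdd_above_summable_on)
      (use sum_le_weight[OF W p] in \<open>auto simp: bdd_above_def\<close>)
  have fin_le: "(\<Sum>x\<in>T. (f x)\<^sup>2) \<le> F" if "finite T" for T
    unfolding F_def by (rule finite_sum_le_infsum[OF summ that]) auto
  have sq: "(\<Sum>x\<in>A. \<bar>f x\<bar>)\<^sup>2 \<le> card A * (\<Sum>x\<in>A. (f x)\<^sup>2)" for A
    using sum_squared_le_sum_of_squares[of "\<lambda>x. \<bar>f x\<bar>" A] by (simp add: mult.commute)
  have cardX: "real (card (dyadic_box K :: (int ^ 'n) set)) = 2 powr (d * (real K + 1))" for K
    by (simp add: card_dyadic_box card_UNIV)
  let ?X = "dyadic_box J :: (int ^ 'n) set" and ?Y = "dyadic_box I :: (int ^ 'n) set"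
  have YX: "?Y \<subseteq> ?X" by (rule dyadic_box_mono) (simp add: J)
  have inner: "(\<Sum>x\<in>?Y. \<bar>f x\<bar>)\<^sup>2 \<le> 2 powr (d * (real I + 1)) * F"
    using sq[of ?Y] mult_left_mono[OF fin_le[of ?Y], of "2 powr (d * (real I + 1))"]
    unfolding cardX by (rule order.trans) auto
  have outer: "(\<Sum>x\<in>?X - ?Y. \<bar>f x\<bar>)\<^sup>2 \<le> 2 powr (d * (real J + 1)) * (2 powr (- p * I) * W\<^sup>2)"
  proof -
    have "card (?X - ?Y) \<le> card ?X" by (rule card_mono) auto
    then have "real (card (?X - ?Y)) \<le> 2 powr (d * (real J + 1))" by (simp flip: cardX)
    then show ?thesis
      by (intro order.trans[OF sq] mult_mono tail_le W p) (auto intro: sum_nonneg)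
  qed
  have "(\<Sum>x\<in>?X. \<bar>f x\<bar>) = (\<Sum>x\<in>?Y. \<bar>f x\<bar>) + (\<Sum>x\<in>?X - ?Y. \<bar>f x\<bar>)"
    using sum.subset_diff[OF YX] by (simp add: add.commute)
  then have "(\<Sum>x\<in>?X. \<bar>f x\<bar>)\<^sup>2 \<le> 2 * (\<Sum>x\<in>?Y. \<bar>f x\<bar>)\<^sup>2 + 2 * (\<Sum>x\<in>?X - ?Y. \<bar>f x\<bar>)\<^sup>2"
    using sum_squares_bound[of "\<Sum>x\<in>?Y. \<bar>f x\<bar>" "\<Sum>x\<in>?X - ?Y. \<bar>f x\<bar>"]
    by (simp add: power2_sum)
  with inner outer have L1: "(\<Sum>x\<in>?X. \<bar>f x\<bar>)\<^sup>2 \<le> 2 * (2 powr (d * (real I + 1)) * F)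
      + 2 * (2 powr (d * (real J + 1)) * (2 powr (- p * I) * W\<^sup>2))" by linarith
  have F0: "F \<ge> 0" using fin_le[of "{}"] by simp
  have "2 powr (- d * J) * (\<Sum>x\<in>?X. \<bar>f x\<bar>)\<^sup>2 \<le>
      2 * (2 powr (- d * J) * 2 powr (d * (real I + 1))) * F
      + 2 * (2 powr (- d * J) * 2 powr (d * (real J + 1)) * 2 powr (- p * I)) * W\<^sup>2"
    using mult_left_mono[OF L1, of "2 powr (- d * J)"] by (simp add: algebra_simps)
  also have "2 * (2 powr (- d * J) * 2 powr (d * (real J + 1)) * 2 powr (- p * I))
      = 2 powr (1 + d + 3 * p) * 2 powr (- p * J)"
    unfolding J by (simp add: powr_add[symmetric] powr_mult_base algebra_simps)
  also have "2 powr (- d * J) * 2 powr (d * (real I + 1)) = 2 powr (- 2 * d)"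
    unfolding J by (simp add: powr_add[symmetric] algebra_simps)
  also have "2 * 2 powr (- 2 * d) * F \<le> 1/2 * F"
  proof (intro mult_right_mono F0)
    have "2 powr (- 2 * d) \<le> 2 powr (- 2 :: real)" using dim by (intro powr_mono) auto
    then show "2 * 2 powr (- 2 * d) \<le> 1/2" by (simp add: powr_minus)
  qed
  finally have "2 powr (- d * J) * (\<Sum>x\<in>?X. \<bar>f x\<bar>)\<^sup>2
    \<le> 1/2 * F + 2 powr (1 + d + 3 * p) * 2 powr (- p * J) * W\<^sup>2" by simp
  moreover have "\<sigma> * J + d * \<kappa> * J = J" by (simp add: \<sigma>_def algebra_simps)
  ultimately have box: "(\<Sum>x\<in>?X. (f x)\<^sup>2) \<le> c\<^sub>1 * (2 powr J * (M * E))\<^sup>2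
     + (1/2 * F + 2 powr (1 + d + 3 * p) * 2 powr (- p * J) * W\<^sup>2)"
    using dyadic_box_bound[of J J] by simp
  have "F \<le> c\<^sub>1 * (2 powr J * (M * E))\<^sup>2
     + (1/2 * F + 2 powr (1 + d + 3 * p) * 2 powr (- p * J) * W\<^sup>2) + 2 powr (- p * J) * W\<^sup>2"
    unfolding F_def
  proof (rule infsum_le_finite_sums[OF summ], fold F_def)
    fix T :: "(int ^ 'n) set" assume "finite T"
    from sum_le_dyadic[OF W p this, of J] box
    show "(\<Sum>x\<in>T. (f x)\<^sup>2) \<le> c\<^sub>1 * (2 powr J * (M * E))\<^sup>2
     + (1/2 * F + 2 powr (1 + d + 3 * p) * 2 powr (- p * J) * W\<^sup>2) + 2 powr (- p * J) * W\<^sup>2"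
      by linarith
  qed
  then have "F \<le> 2 * c\<^sub>1 * (2 powr J * (M * E))\<^sup>2
    + 2 * (1 + 2 powr (1 + d + 3 * p)) * (2 powr (- p * J) * W\<^sup>2)"
    by (simp add: algebra_simps)
  with fin_le[OF S] show ?thesis by linarith
qed

text \<open>Below scale 1 the weight bound alone suffices, as the weight is at least 1; otherwise
  \<open>R\<close> is rounded down to a dyadic scale. \<open>D\<close> is a free parameter above
  \<open>M * E\<close> so that it can be positive even if \<open>M * E = 0\<close>.\<close>

lemma one_scale_bound:
  assumes W: "weight_bound p W" and p: "p \<ge> 0" and S: "finite S" and R: "R > 0" and D: "M * E \<le> D"
  shows "(\<Sum>x\<in>S. (f x)\<^sup>2) \<le> c\<^sub>2 p * ((R * D)\<^sup>2 + R powr (- p) * W\<^sup>2)"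
proof (cases "R \<ge> 1")
  case False
  have "R powr p \<le> 1" using False R p by (simp add: powr_le1)
  then have "1 \<le> R powr (- p)" using R by (simp add: powr_minus field_simps)
  then have "W\<^sup>2 \<le> R powr (- p) * W\<^sup>2" using mult_right_mono[of 1 "R powr (- p)" "W\<^sup>2"] by simp
  also have "\<dots> \<le> (R * D)\<^sup>2 + R powr (- p) * W\<^sup>2" by simp
  also have "\<dots> \<le> c\<^sub>2 p * \<dots>"
    using c\<^sub>2_ge(2)[of p] by (intro self_le_mult add_nonneg_nonneg) auto
  finally show ?thesis using sum_le_weight[OF W p S] by linarith
next
  case True
  obtain J :: nat where J: "2 powr J \<le> R" "R < 2 * 2 powr J" using dyadic_scale[OF True] .
  have ME: "0 \<le> M * E" using M_nonneg E_nonneg by simp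
  have "2 * c\<^sub>1 * (2 powr J * (M * E))\<^sup>2 \<le> c\<^sub>2 p * (R * D)\<^sup>2"
    using J D R ME c\<^sub>2_ge[of p] by (intro mult_mono power_mono) auto
  moreover have "2 powr (- p * J) \<le> 2 powr p * R powr (- p)"
  proof -
    have "R powr p \<le> (2 * 2 powr J) powr p" using J p R by (intro powr_mono2) auto
    also have "\<dots> = 2 powr p * 2 powr (p * J)" by (simp add: powr_mult powr_powr mult.commute)
    finally show ?thesis using R by (simp add: powr_minus field_simps)
  qed
  then have "2 * (1 + 2 powr (1 + d + 3 * p)) * (2 powr (- p * J) * W\<^sup>2)
      \<le> 2 * (1 + 2 powr (1 + d + 3 * p)) * (2 powr p * R powr (- p) * W\<^sup>2)"
    by (intro mult_left_mono mult_right_mono) (auto simp: add_nonneg_nonneg)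
  moreover have "\<dots> = 2 * 2 powr p * (1 + 2 powr (1 + d + 3 * p)) * (R powr (- p) * W\<^sup>2)" by simp
  moreover have "\<dots> \<le> c\<^sub>2 p * (R powr (- p) * W\<^sup>2)"
    by (intro mult_right_mono c\<^sub>2_ge) auto
  ultimately show ?thesis
    using dyadic_moment_bound[OF W p S, of J] unfolding distrib_left[of "c\<^sub>2 p"] by linarith
qed

lemma sum_le_sum_bound:
  assumes "sum_bound N" "finite S"
  shows "(\<Sum>x\<in>S. (f x)\<^sup>2) \<le> N\<^sup>2"
proof -
  have "(\<Sum>x\<in>S. (f x)\<^sup>2) = (\<Sum>x\<in>S. \<bar>f x\<bar> * \<bar>f x\<bar>)" by (simp add: power2_eq_square)
  also have "\<dots> \<le> (\<Sum>x\<in>S. \<bar>f x\<bar> * (\<Sum>x\<in>S. \<bar>f x\<bar>))"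
    by (intro sum_mono mult_left_mono) (auto intro: member_le_sum assms)
  also have "\<dots> = (\<Sum>x\<in>S. \<bar>f x\<bar>)\<^sup>2" by (simp add: power2_eq_square sum_distrib_right)
  also have "\<dots> \<le> N\<^sup>2" using assms by (intro power_mono) (auto simp: sum_bound_def sum_nonneg)
  finally show ?thesis .
qed

text \<open>Below the lattice spacing the estimate reduces to the domination of the l2 norm by the
  l1 norm.\<close>

lemma scale_below_one:
  assumes "sum_bound N" "finite S" "0 < \<rho>" "\<rho> < 1"
  shows "(\<Sum>x\<in>S. (f x)\<^sup>2) \<le> c\<^sub>2 p * (\<rho> powr (- d) * N\<^sup>2)"
proof -
  have "\<rho> powr d \<le> 1" using assms dim by (simp add: powr_le1)
  then have "1 \<le> \<rho> powr (- d)" using assms by (simp add: powr_minus field_simps)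
  then have "N\<^sup>2 \<le> \<rho> powr (- d) * N\<^sup>2" using mult_right_mono[of 1 "\<rho> powr (- d)" "N\<^sup>2"] by simp
  also have "\<dots> \<le> c\<^sub>2 p * \<dots>"
    using c\<^sub>2_ge(2)[of p] by (intro self_le_mult) auto
  finally show ?thesis using sum_le_sum_bound[OF assms(1,2)] by linarith
qed

lemma dyadic_box_two_scales:
  fixes K J :: nat
  assumes N: "sum_bound N" and D: "M * E \<le> D"
    and K: "2 powr K \<le> \<rho>" "\<rho> < 2 * 2 powr K" and J: "2 powr J \<le> R" and "K \<le> J"
  shows "(\<Sum>x\<in>dyadic_box J. (f x)\<^sup>2) \<le> c\<^sub>2 p * (\<rho> powr \<sigma> * R powr (d * \<kappa>) * D)\<^sup>2 + c\<^sub>2 p * (\<rho> powr (- d) * N\<^sup>2)"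
proof -
  have ME: "0 \<le> M * E" using M_nonneg E_nonneg by simp
  have pos: "\<rho> > 0" "R > 0"
    using K(1) J by (auto intro: less_le_trans[of 0 "2 powr real _"])
  have d\<kappa>: "0 \<le> d * \<kappa>" using dim \<kappa> by simp
  have "2 powr (\<sigma> * K + d * \<kappa> * J) = (2 powr K) powr \<sigma> * (2 powr J) powr (d * \<kappa>)"
    by (simp add: powr_add powr_powr mult_ac)
  also have "\<dots> \<le> \<rho> powr \<sigma> * R powr (d * \<kappa>)"
    using K J \<sigma>_pos d\<kappa> by (intro mult_mono powr_mono2) auto
  finally have "c\<^sub>1 * (2 powr (\<sigma> * K + d * \<kappa> * J) * (M * E))\<^sup>2 \<le> c\<^sub>2 p * (\<rho> powr \<sigma> * R powr (d * \<kappa>) * D)\<^sup>2"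
    using D ME c\<^sub>2_ge[of p] by (intro mult_mono power_mono) auto
  moreover have "2 powr (- d * K) \<le> 2 powr d * \<rho> powr (- d)"
  proof -
    have "\<rho> powr d \<le> (2 * 2 powr K) powr d" using K pos dim by (intro powr_mono2) auto
    also have "\<dots> = 2 powr d * 2 powr (d * K)" by (simp add: powr_mult powr_powr mult.commute)
    finally show ?thesis using pos by (simp add: powr_minus field_simps)
  qed
  then have "2 powr (- d * K) * (\<Sum>x\<in>dyadic_box J. \<bar>f x\<bar>)\<^sup>2 \<le> (c\<^sub>2 p * \<rho> powr (- d)) * N\<^sup>2"
    using N c\<^sub>2_ge(2,3)[of p] mult_right_mono[OF c\<^sub>2_ge(3)[of p], of "\<rho> powr (- d)"]
    by (intro mult_mono power_mono) (auto simp: sum_bound_def sum_nonneg)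
  ultimately show ?thesis
    using dyadic_box_bound[OF \<open>K \<le> J\<close>] by (simp add: mult.assoc)
qed

text \<open>\<open>R\<close> fixes the box outside which the weight takes over, and \<rho> the size
  of the cubes into which that box is cut.\<close>

lemma two_scale_bound:
  assumes W: "weight_bound p W" and N: "sum_bound N" and p: "p \<ge> 0" and S: "finite S"
    and D: "M * E \<le> D" and \<rho>: "0 < \<rho>" "\<rho> \<le> R"
  shows "(\<Sum>x\<in>S. (f x)\<^sup>2)
    \<le> c\<^sub>2 p * ((\<rho> powr \<sigma> * R powr (d * \<kappa>) * D)\<^sup>2 + \<rho> powr (- d) * N\<^sup>2 + R powr (- p) * W\<^sup>2)"
proof (cases "\<rho> \<ge> 1")
  case False
  have "(\<Sum>x\<in>S. (f x)\<^sup>2) \<le> c\<^sub>2 p * (\<rho> powr (- d) * N\<^sup>2)"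
    using scale_below_one[OF N S] False \<rho> by simp
  also have "\<dots> \<le> c\<^sub>2 p * ((\<rho> powr \<sigma> * R powr (d * \<kappa>) * D)\<^sup>2 + \<rho> powr (- d) * N\<^sup>2 + R powr (- p) * W\<^sup>2)"
    using c\<^sub>2_ge(2)[of p] by (intro mult_left_mono) auto
  finally show ?thesis .
next
  case True
  obtain K :: nat where K: "2 powr K \<le> \<rho>" "\<rho> < 2 * 2 powr K" using dyadic_scale[OF True] .
  obtain J :: nat where J: "2 powr J \<le> R" "R < 2 * 2 powr J" using dyadic_scale[of R] True \<rho> by auto
  have "2 powr real K < 2 powr (real J + 1)" using K J \<rho> by (simp add: powr_add)
  then have "K \<le> J" by simp
  have "2 powr (- p * J) \<le> 2 powr p * R powr (- p)"
  proof -
    have "R powr p \<le> (2 * 2 powr J) powr p" using J p \<rho> by (intro powr_mono2) auto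
    also have "\<dots> = 2 powr p * 2 powr (p * J)" by (simp add: powr_mult powr_powr mult.commute)
    finally show ?thesis using \<rho> by (simp add: powr_minus field_simps)
  qed
  also have "\<dots> \<le> c\<^sub>2 p * R powr (- p)" by (intro mult_right_mono c\<^sub>2_ge) auto
  finally have "2 powr (- p * J) * W\<^sup>2 \<le> c\<^sub>2 p * R powr (- p) * W\<^sup>2" by (intro mult_right_mono) auto
  with sum_le_dyadic[OF W p S, of J] dyadic_box_two_scales[OF N D K J(1) \<open>K \<le> J\<close>, of p]
  show ?thesis by (simp add: algebra_simps)
qed

text \<open>For \<kappa> = 0 the moment bound does not deteriorate with the box, so the box may be
  enlarged until it contains \<open>S\<close> and no tail remains. This serves the endpoint \<theta>
  = 0.\<close>

lemma unweighted_bound: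
  assumes N: "sum_bound N" and S: "finite S" and D: "M * E \<le> D" and \<rho>: "0 < \<rho>" and \<kappa>0: "\<kappa> = 0"
  shows "(\<Sum>x\<in>S. (f x)\<^sup>2) \<le> c\<^sub>2 p * ((\<rho> * D)\<^sup>2 + \<rho> powr (- d) * N\<^sup>2)"
proof (cases "\<rho> \<ge> 1")
  case False
  have "(\<Sum>x\<in>S. (f x)\<^sup>2) \<le> c\<^sub>2 p * (\<rho> powr (- d) * N\<^sup>2)"
    using scale_below_one[OF N S] False \<rho> by simp
  also have "\<dots> \<le> c\<^sub>2 p * ((\<rho> * D)\<^sup>2 + \<rho> powr (- d) * N\<^sup>2)"
    using c\<^sub>2_ge(2)[of p] by (intro mult_left_mono) auto
  finally show ?thesis .
next
  case True
  obtain K :: nat where K: "2 powr K \<le> \<rho>" "\<rho> < 2 * 2 powr K" using dyadic_scale[OF True] .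
  obtain I where I: "S \<subseteq> dyadic_box I" using finite_subset_dyadic_box[OF S] .
  define J where "J = max K I"
  have "S \<subseteq> dyadic_box J" using I dyadic_box_mono[of I J] by (auto simp: J_def)
  then have "(\<Sum>x\<in>S. (f x)\<^sup>2) \<le> (\<Sum>x\<in>dyadic_box J. (f x)\<^sup>2)" by (intro sum_mono2) auto
  also have "\<dots> \<le> c\<^sub>2 p * (\<rho> powr \<sigma> * (2 powr J) powr (d * \<kappa>) * D)\<^sup>2 + c\<^sub>2 p * (\<rho> powr (- d) * N\<^sup>2)"
    by (rule dyadic_box_two_scales[OF N D K]) (auto simp: J_def)
  also have "\<rho> powr \<sigma> * (2 powr J) powr (d * \<kappa>) = \<rho>"
    using \<rho> \<kappa>0 unfolding \<sigma>_def by simp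
  finally show ?thesis by (simp add: distrib_left)
qed

end

subsection \<open>Optimisation of the scales\<close>

text \<open>The value \<open>theta_c\<close> in terms of \<open>\<kappa> = 1 / q\<close>, with the division by \<open>\<kappa>\<close> cleared.\<close>

definition crit :: "real \<Rightarrow> real \<Rightarrow> real \<Rightarrow> real" where
  "crit d p \<kappa> = d * \<kappa> * (d * p + 2 * d) / (d * \<kappa> * (d * p + 2 * d) + (d * p + 2 * p) * (1 - d * \<kappa>))"

lemma theta_c_eq_crit:
  assumes "d > 0" "p > 0" "q > ereal d"
  shows "theta_c d p q = crit d p (if q = \<infinity> then 0 else 1 / real_of_ereal q)"
proof (cases q)
  case (real r)
  with assms have r: "r > d" "r > 0" by auto
  have pos: "d * p + 2 * d > 0" using assms by (simp add: add_pos_pos)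
  have "1 / (1 + (d * p + 2 * p) / (d * p + 2 * d) * (r / d - 1)) = crit d p (1 / r)"
  proof -
    have 1: "(d * p + 2 * p) / (d * p + 2 * d) * (r / d - 1)
        = (d * p + 2 * p) * (1 - d * (1 / r)) / (d * (1 / r) * (d * p + 2 * d))"
      using r assms pos by (simp add: divide_simps)
    have A: "d * (1 / r) * (d * p + 2 * d) > 0" using r assms pos by simp
    have "1 / (1 + b / a) = a / (a + b)" if "a > 0" for a b :: real
    proof -
      have "1 + b / a = (a + b) / a" using that by (simp add: add_divide_distrib)
      then show ?thesis by simp
    qed
    from this[OF A] show ?thesis unfolding 1 crit_def .
  qed
  then show ?thesis using real by (simp add: theta_c_def)
qed (use assms in \<open>auto simp: theta_c_def crit_def\<close>)

lemma crit_bounds: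
  assumes "d > 0" "p > 0" "0 \<le> \<kappa>" "d * \<kappa> < 1"
  shows "0 \<le> crit d p \<kappa>" "crit d p \<kappa> < 1"
proof -
  have "0 \<le> d * \<kappa> * (d * p + 2 * d)" using assms by simp
  moreover have "0 < (d * p + 2 * p) * (1 - d * \<kappa>)" using assms by (simp add: add_pos_pos)
  ultimately show "0 \<le> crit d p \<kappa>" "crit d p \<kappa> < 1" by (simp_all add: crit_def)
qed

text \<open>The exponents at \<open>crit\<close> are those for which the three terms of the two-scale bound can be
  made equal by a choice of the scales.\<close>

lemma exponents_crit:
  assumes "d > 0" "p > 0" "0 \<le> \<kappa>" "d * \<kappa> < 1"
  defines "s \<equiv> 1 + 2 * (1 - d * \<kappa>) / d + 2 * d * \<kappa> / p"
  shows "s > 0" "s * exp_alpha d p (crit d p \<kappa>) = 1"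
    "s * exp_beta d (crit d p \<kappa>) = 2 * (1 - d * \<kappa>) / d"
    "s * exp_gamma p (crit d p \<kappa>) = 2 * d * \<kappa> / p"
proof -
  \<comment> \<open>\<open>X\<close> clears the denominators of \<open>s\<close> and is also the
    denominator of \<open>crit\<close>.\<close>
  define X where "X = d * p * s"
  have X: "X = d * p + 2 * p * (1 - d * \<kappa>) + 2 * d * (d * \<kappa>)"
    using assms by (simp add: X_def s_def field_simps)
  have nn: "0 \<le> d * \<kappa>" using assms by simp
  have X0: "X > 0" unfolding X using assms nn by (intro add_pos_nonneg) auto
  have s: "s = X / (d * p)" using assms(1,2) by (simp add: X_def)
  show "s > 0" unfolding s using X0 assms(1,2) by simp
  have den: "d * \<kappa> * (d * p + 2 * d) + (d * p + 2 * p) * (1 - d * \<kappa>) = X"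
    unfolding X by (simp add: algebra_simps)
  have \<theta>: "crit d p \<kappa> = d * \<kappa> * (d * p + 2 * d) / X" unfolding crit_def den ..
  have 1: "1 - crit d p \<kappa> = p * (d + 2) * (1 - d * \<kappa>) / X"
    using X0 unfolding \<theta> by (simp add: field_simps) (simp add: X algebra_simps)
  show b: "s * exp_beta d (crit d p \<kappa>) = 2 * (1 - d * \<kappa>) / d"
    unfolding exp_beta_def 1 s using assms(1,2) X0 by (simp add: divide_simps)
  show g: "s * exp_gamma p (crit d p \<kappa>) = 2 * d * \<kappa> / p"
    unfolding exp_gamma_def \<theta> s using assms(1,2) X0 by (simp add: divide_simps) (simp add: algebra_simps)
  \<comment> \<open>The exponents sum to 1, as linear scaling in \<open>f\<close> demands; the third
    identity thus follows from the other two.\<close>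
  have "exp_alpha d p t + exp_beta d t + exp_gamma p t = 1" for t
    unfolding exp_alpha_def exp_beta_def exp_gamma_def using assms(1,2)
    by (simp add: divide_simps) (simp add: algebra_simps)
  then have "exp_alpha d p (crit d p \<kappa>) = 1 - exp_beta d (crit d p \<kappa>) - exp_gamma p (crit d p \<kappa>)"
    by (smt (verit))
  then show "s * exp_alpha d p (crit d p \<kappa>) = 1"
    by (simp add: right_diff_distrib b g) (simp add: s_def)
qed

definition nash_product :: "real \<Rightarrow> real \<Rightarrow> real \<Rightarrow> real \<Rightarrow> real \<Rightarrow> real \<Rightarrow> real" where
  "nash_product d p \<theta> D N W = D powr exp_alpha d p \<theta> * N powr exp_beta d \<theta> * W powr exp_gamma p \<theta>"

lemma nash_product_exp:
  "nash_product d p \<theta> (exp x) (exp y) (exp z) = exp (exp_alpha d p \<theta> * x + exp_beta d \<theta> * y + exp_gamma p \<theta> * z)"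
  by (simp add: nash_product_def exp_powr_real exp_add mult_ac)

text \<open>All three exponents are affine in \<theta>, hence so is the logarithm of the
  product.\<close>

lemma nash_product_interpolate:
  assumes "D > 0" "N > 0" "W > 0"
  shows "nash_product d p ((1 - t) * \<theta>\<^sub>0 + t * \<theta>\<^sub>1) D N W
     = nash_product d p \<theta>\<^sub>0 D N W powr (1 - t) * nash_product d p \<theta>\<^sub>1 D N W powr t"
proof -
  obtain x y z where *: "D = exp x" "N = exp y" "W = exp z"
    using assms by (metis exp_ln)
  have aff: "(1 - ((1 - t) * \<theta>\<^sub>0 + t * \<theta>\<^sub>1)) * k + ((1 - t) * \<theta>\<^sub>0 + t * \<theta>\<^sub>1) * l
      = (1 - t) * ((1 - \<theta>\<^sub>0) * k + \<theta>\<^sub>0 * l) + t * ((1 - \<theta>\<^sub>1) * k + \<theta>\<^sub>1 * l)" for k l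
    by (simp add: algebra_simps)
  show ?thesis unfolding * nash_product_exp exp_powr_real exp_add[symmetric]
    using aff[of "d / (d + 2)" "p / (p + 2)"] aff[of "2 / (d + 2)" 0] aff[of 0 "2 / (p + 2)"]
    unfolding exp_alpha_def exp_beta_def exp_gamma_def by (simp add: algebra_simps)
qed

section \<open>The inequality at \<theta> = 1, at \<open>crit\<close>, at 0 and in between\<close>

context anchored_weight
begin

lemma nash_one:
  assumes W: "weight_bound p W" and p: "p > 0" and S: "finite S" and D: "M * E \<le> D" "D > 0" and "W > 0" "N > 0"
  shows "(\<Sum>x\<in>S. (f x)\<^sup>2) \<le> 3 * c\<^sub>2 p * (nash_product d p 1 D N W)\<^sup>2"
proof -
  obtain x y z where *: "D = exp x" "N = exp y" "W = exp z"
    using assms by (metis exp_ln)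
  \<comment> \<open>The logarithm of the scale \<open>R\<close> at which \<open>R * D\<close> equals
    \<open>R powr (- p / 2) * W\<close>.\<close>
  define r where "r = 2 / (p + 2) * (z - x)"
  let ?T = "nash_product d p 1 D N W"
  have T: "?T = exp (p / (p + 2) * x + 2 / (p + 2) * z)"
    unfolding * nash_product_exp by (simp add: exp_alpha_def exp_beta_def exp_gamma_def)
  have "r + x = p / (p + 2) * x + 2 / (p + 2) * z"
    using p by (simp add: r_def divide_simps) (simp add: algebra_simps)
  then have "exp r * D = ?T" unfolding T by (simp add: * exp_add[symmetric])
  moreover have "- p * r + 2 * z = 2 * (p / (p + 2) * x + 2 / (p + 2) * z)"
    using p by (simp add: r_def divide_simps) (simp add: algebra_simps)
  then have "exp r powr (- p) * W\<^sup>2 = ?T\<^sup>2"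
    unfolding T by (simp add: * exp_powr_real exp_double[symmetric] exp_add[symmetric] mult.commute)
  moreover have "(\<Sum>x\<in>S. (f x)\<^sup>2) \<le> c\<^sub>2 p * ((exp r * D)\<^sup>2 + exp r powr (- p) * W\<^sup>2)"
    using one_scale_bound[OF W _ S _ D(1), of "exp r"] p by simp
  ultimately have "(\<Sum>x\<in>S. (f x)\<^sup>2) \<le> c\<^sub>2 p * (2 * ?T\<^sup>2)" by simp
  also have "\<dots> \<le> 3 * c\<^sub>2 p * ?T\<^sup>2"
    using c\<^sub>2_ge(2)[of p] by (simp add: mult_right_mono)
  finally show ?thesis .
qed

lemma nash_crit:
  assumes W: "weight_bound p W" and N: "sum_bound N" and p: "p > 0" and S: "finite S"
    and D: "M * E \<le> D" "D > 0" and "W > 0" "N > 0"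
  shows "(\<Sum>x\<in>S. (f x)\<^sup>2) \<le> 3 * c\<^sub>2 p * (nash_product d p (crit d p \<kappa>) D N W)\<^sup>2"
proof -
  obtain x y z where *: "D = exp x" "N = exp y" "W = exp z"
    using assms by (metis exp_ln)
  let ?T = "nash_product d p (crit d p \<kappa>) D N W"
  define s where "s = 1 + 2 * (1 - d * \<kappa>) / d + 2 * d * \<kappa> / p"
  have d: "d > 0" using dim by simp
  note ex = exponents_crit[OF d p \<kappa>, folded s_def]
  define t where "t = exp_alpha d p (crit d p \<kappa>) * x + exp_beta d (crit d p \<kappa>) * y + exp_gamma p (crit d p \<kappa>) * z"
  have T: "?T = exp t" unfolding * nash_product_exp t_def ..
  have st: "s * t = x + 2 * \<sigma> / d * y + 2 * d * \<kappa> / p * z"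
    unfolding t_def distrib_left mult.assoc[symmetric] ex \<sigma>_def by simp
  \<comment> \<open>Logarithms of the scales, chosen so that the l1 term and the weight term both
    equal \<open>?T\<^sup>2\<close>; by \<open>exponents_crit\<close> the gradient term then equals
    it too.\<close>
  define \<rho> R where "\<rho> = 2 / d * (y - t)" and "R = 2 / p * (z - t)"
  have "\<sigma> * \<rho> + d * \<kappa> * R + x = t"
  proof -
    have "\<sigma> * \<rho> + d * \<kappa> * R + x = (x + 2 * \<sigma> / d * y + 2 * d * \<kappa> / p * z) - (2 * \<sigma> / d + 2 * d * \<kappa> / p) * t"
      by (simp add: \<rho>_def R_def algebra_simps diff_divide_distrib)
    also have "2 * \<sigma> / d + 2 * d * \<kappa> / p = s - 1" by (simp add: s_def \<sigma>_def)
    finally show ?thesis unfolding st[symmetric] by (simp add: algebra_simps)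
  qed
  then have 1: "exp \<rho> powr \<sigma> * exp R powr (d * \<kappa>) * D = ?T"
    unfolding T by (simp add: * exp_powr_real exp_add[symmetric] mult.commute)
  have 2: "exp \<rho> powr (- d) * N\<^sup>2 = ?T\<^sup>2"
    unfolding T using d by (simp add: * exp_powr_real exp_double[symmetric] exp_add[symmetric] \<rho>_def)
  have 3: "exp R powr (- p) * W\<^sup>2 = ?T\<^sup>2"
    unfolding T using p by (simp add: * exp_powr_real exp_double[symmetric] exp_add[symmetric] R_def)
  show ?thesis
  proof (cases "\<rho> \<le> R")
    case True
    have "(\<Sum>x\<in>S. (f x)\<^sup>2) \<le> c\<^sub>2 p * (?T\<^sup>2 + ?T\<^sup>2 + ?T\<^sup>2)"
      using two_scale_bound[OF W N _ S D(1), of "exp \<rho>" "exp R"] True p unfolding 1 2 3 by simp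
    then show ?thesis by simp
  next
    \<comment> \<open>The scales come out in the wrong order for the two-scale bound. The one-scale
      bound at \<open>R\<close> suffices, since \<rho> exceeding \<open>R\<close> makes its gradient
      term at most \<open>?T\<^sup>2\<close>.\<close>
    case False
    have "exp R = exp R powr \<sigma> * exp R powr (d * \<kappa>)"
      by (simp add: \<sigma>_def flip: powr_add)
    also have "\<dots> \<le> exp \<rho> powr \<sigma> * exp R powr (d * \<kappa>)"
      using False \<sigma>_pos by (intro mult_right_mono powr_mono2) auto
    finally have "exp R * D \<le> ?T" unfolding 1[symmetric] using D by (intro mult_right_mono) auto
    then have "(exp R * D)\<^sup>2 \<le> ?T\<^sup>2" using D by (intro power_mono) auto
    then have "c\<^sub>2 p * ((exp R * D)\<^sup>2 + ?T\<^sup>2) \<le> c\<^sub>2 p * (3 * ?T\<^sup>2)"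
      using c\<^sub>2_ge(2)[of p] zero_le_power2[of ?T] by (intro mult_left_mono) (linarith, linarith)
    with one_scale_bound[OF W _ S _ D(1), of "exp R"] p show ?thesis unfolding 3 by simp
  qed
qed

lemma nash_zero:
  assumes N: "sum_bound N" and S: "finite S" and D: "M * E \<le> D" "D > 0" and "N > 0" "W > 0" and \<kappa>0: "\<kappa> = 0"
  shows "(\<Sum>x\<in>S. (f x)\<^sup>2) \<le> 3 * c\<^sub>2 p * (nash_product d p 0 D N W)\<^sup>2"
proof -
  obtain x y z where *: "D = exp x" "N = exp y" "W = exp z"
    using assms by (metis exp_ln)
  have d: "d > 0" using dim by simp
  \<comment> \<open>The logarithm of the scale \<rho> at which \<open>\<rho> * D\<close> equals
    \<open>\<rho> powr (- d / 2) * N\<close>.\<close>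
  define r where "r = 2 / (d + 2) * (y - x)"
  let ?T = "nash_product d p 0 D N W"
  have T: "?T = exp (d / (d + 2) * x + 2 / (d + 2) * y)"
    unfolding * nash_product_exp by (simp add: exp_alpha_def exp_beta_def exp_gamma_def)
  have "r + x = d / (d + 2) * x + 2 / (d + 2) * y"
    using d by (simp add: r_def divide_simps) (simp add: algebra_simps)
  then have "exp r * D = ?T" unfolding T by (simp add: * exp_add[symmetric])
  moreover have "- d * r + 2 * y = 2 * (d / (d + 2) * x + 2 / (d + 2) * y)"
    using d by (simp add: r_def divide_simps) (simp add: algebra_simps)
  then have "exp r powr (- d) * N\<^sup>2 = ?T\<^sup>2"
    unfolding T by (simp add: * exp_powr_real exp_double[symmetric] exp_add[symmetric] mult.commute)
  moreover have "(\<Sum>x\<in>S. (f x)\<^sup>2) \<le> c\<^sub>2 p * ((exp r * D)\<^sup>2 + exp r powr (- d) * N\<^sup>2)"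
    using unweighted_bound[OF N S D(1) _ \<kappa>0, of "exp r"] by simp
  ultimately have "(\<Sum>x\<in>S. (f x)\<^sup>2) \<le> c\<^sub>2 p * (2 * ?T\<^sup>2)" by simp
  also have "\<dots> \<le> 3 * c\<^sub>2 p * ?T\<^sup>2"
    using c\<^sub>2_ge(2)[of p] by (simp add: mult_right_mono)
  finally show ?thesis .
qed

text \<open>A value strictly between 0 and 1 is reached by interpolating between \<open>crit\<close>
  and 1. The bounds by \<open>W\<close> and \<open>N\<close> are assumed only where their exponents
  are positive, since a norm with exponent 0 may be infinite.\<close>

lemma nash_pos:
  assumes W: "\<theta> > 0 \<Longrightarrow> weight_bound p W" and N: "\<theta> < 1 \<Longrightarrow> sum_bound N" and p: "p > 0"
    and \<theta>: "crit d p \<kappa> \<le> \<theta>" "\<theta> \<le> 1"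
    and S: "finite S" and D: "M * E \<le> D" "D > 0" and WN: "W > 0" "N > 0"
  shows "(\<Sum>x\<in>S. (f x)\<^sup>2) \<le> 3 * c\<^sub>2 p * (nash_product d p \<theta> D N W)\<^sup>2"
proof -
  have d: "d > 0" using dim by simp
  note cb = crit_bounds[OF d p \<kappa>]
  consider "\<theta> = 1" | "\<theta> = 0" | "0 < \<theta>" "\<theta> < 1" using \<theta> cb by linarith
  then show ?thesis
  proof cases
    case 1
    then show ?thesis using nash_one[OF W p S D WN] by simp
  next
    case 2
    then have "crit d p \<kappa> = 0" using \<theta> cb by simp
    \<comment> \<open>When \<open>crit\<close> is 0, the identity for \<open>exp_gamma\<close> in
      \<open>exponents_crit\<close> reads \<open>0 = 2 * d * \<kappa> / p\<close>.\<close>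
    then have "\<kappa> = 0"
      using d p cb \<kappa> exponents_crit[OF d p \<kappa>] by (auto simp: exp_gamma_def)
    then show ?thesis using nash_zero[OF N S D WN(2,1)] 2 by simp
  next
    case 3
    define t where "t = (\<theta> - crit d p \<kappa>) / (1 - crit d p \<kappa>)"
    have t: "0 \<le> t" "t \<le> 1" using \<theta> cb by (auto simp: t_def)
    have "t * (1 - crit d p \<kappa>) = \<theta> - crit d p \<kappa>" using cb by (simp add: t_def)
    then have \<theta>_eq: "\<theta> = (1 - t) * crit d p \<kappa> + t * 1" by (simp add: algebra_simps)
    have "nash_product d p \<theta> D N W
        = nash_product d p (crit d p \<kappa>) D N W powr (1 - t) * nash_product d p 1 D N W powr t"
      by (subst \<theta>_eq, rule nash_product_interpolate) (use D WN in auto)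
    then show ?thesis
      using square_bound_interpolate[OF nash_crit[OF W N p S D WN] nash_one[OF W p S D WN]]
        3 t c\<^sub>2_ge(2)[of p] D WN by (simp add: nash_product_def)
  qed
qed

text \<open>If \<open>M * E = 0\<close>, then \<open>nash_pos\<close> holds for every
  \<open>D > 0\<close>, and \<open>D\<close> tends to 0 from the right; the product vanishes in the
  limit because the exponent of \<open>D\<close> is positive.\<close>

lemma nash:
  assumes W: "\<theta> > 0 \<Longrightarrow> weight_bound p W" and N: "\<theta> < 1 \<Longrightarrow> sum_bound N" and p: "p > 0"
    and \<theta>: "crit d p \<kappa> \<le> \<theta>" "\<theta> \<le> 1"
    and S: "finite S" and WN: "W > 0" "N > 0"
  shows "(\<Sum>x\<in>S. (f x)\<^sup>2) \<le> 3 * c\<^sub>2 p * (nash_product d p \<theta> (M * E) N W)\<^sup>2"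
proof (cases "M * E = 0")
  case False
  then have "M * E > 0" using M_nonneg E_nonneg by simp
  then show ?thesis using nash_pos[OF W N p \<theta> S order.refl _ WN] by simp
next
  case True
  have d: "d > 0" using dim by simp
  have "exp_alpha d p \<theta> > 0"
  proof -
    have "0 \<le> \<theta>" using crit_bounds[OF d p \<kappa>] \<theta> by simp
    then show ?thesis using d p \<theta> unfolding exp_alpha_def
      by (cases "\<theta> = 1") (auto intro!: add_pos_nonneg mult_pos_pos divide_pos_pos)
  qed
  then have "((\<lambda>D. D powr exp_alpha d p \<theta>) \<longlongrightarrow> 0) (at_right 0)"
    by (intro tendsto_zero_powrI[where b = "exp_alpha d p \<theta>"] tendsto_const tendsto_ident_at)
       (auto simp: eventually_at_filter)
  then have "((\<lambda>D. 3 * c\<^sub>2 p * (nash_product d p \<theta> D N W)\<^sup>2) \<longlongrightarrow> 3 * c\<^sub>2 p * (0 * N powr exp_beta d \<theta> * W powr exp_gamma p \<theta>)\<^sup>2) (at_right 0)"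
    unfolding nash_product_def by (intro tendsto_intros)
  then have "((\<lambda>D. 3 * c\<^sub>2 p * (nash_product d p \<theta> D N W)\<^sup>2) \<longlongrightarrow> 0) (at_right 0)" by simp
  moreover have "\<forall>\<^sub>F D in at_right 0. (\<Sum>x\<in>S. (f x)\<^sup>2) \<le> 3 * c\<^sub>2 p * (nash_product d p \<theta> D N W)\<^sup>2"
    using nash_pos[OF W N p \<theta> S _ _ WN] True by (auto simp: eventually_at_filter)
  ultimately have "(\<Sum>x\<in>S. (f x)\<^sup>2) \<le> 0" by (intro tendsto_lowerbound) auto
  then show ?thesis unfolding nash_product_def True by simp
qed

end

subsection \<open>Extended real arithmetic\<close>

lemma itimes_eq_top: "x \<odot> y = top \<longleftrightarrow> x = top \<or> y = top"
  by (auto simp: itimes_def ennreal_mult_eq_top_iff)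

lemma itimes_ennreal: "x \<ge> 0 \<Longrightarrow> y \<ge> 0 \<Longrightarrow> ennreal x \<odot> ennreal y = ennreal (x * y)"
  by (simp add: itimes_def ennreal_mult)

lemma epowr_eq_top: "a > 0 \<Longrightarrow> x epowr a = top \<longleftrightarrow> x = top"
  by (auto simp: epowr_def)

lemma epowr_finite: "a > 0 \<Longrightarrow> x \<noteq> top \<Longrightarrow> x epowr a = ennreal (enn2real x powr a)"
  by (auto simp: epowr_def)

text \<open>Replaces a norm by a positive real: for \<open>a > 0\<close> it is \<open>x\<close>
  itself, while for \<open>a = 0\<close> the power is 1 even if \<open>x\<close> is infinite, and
  \<open>r = 1\<close> represents it.\<close>

lemma epowr_pos:
  assumes "a \<ge> 0" "x \<noteq> 0" "a > 0 \<Longrightarrow> x \<noteq> top"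
  shows "\<exists>r>0. x epowr a = ennreal (r powr a) \<and> (a > 0 \<longrightarrow> x = ennreal r)"
proof (cases "a = 0")
  case True
  then show ?thesis by (intro exI[of _ 1]) (auto simp: epowr_def)
next
  case False
  with assms have a: "a > 0" "x \<noteq> top" by auto
  then obtain r where "x = ennreal r" "r \<ge> 0" by (cases x) auto
  with a assms(2) show ?thesis by (intro exI[of _ r]) (auto simp: epowr_finite)
qed

lemma lnorm_bound:
  assumes "lnorm a S g \<noteq> top" "a > 0" "finite T" "T \<subseteq> S"
  shows "(\<Sum>x\<in>T. \<bar>g x\<bar> powr a) \<le> enn2real (lnorm a S g) powr a"
proof -
  let ?I = "\<integral>\<^sup>+ x. ennreal (\<bar>g x\<bar> powr a) \<partial>count_space S"
  have I: "?I \<noteq> top" using assms by (simp add: lnorm_def epowr_eq_top)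
  have "ennreal (\<Sum>x\<in>T. \<bar>g x\<bar> powr a) = (\<integral>\<^sup>+ x. ennreal (\<bar>g x\<bar> powr a) * indicator T x \<partial>count_space S)"
    using assms by (subst nn_integral_indicator_finite) (auto simp: subset_iff)
  also have "\<dots> \<le> ?I" by (intro nn_integral_mono) (auto simp: indicator_def)
  also have "?I = ennreal (enn2real ?I)" using I by (simp add: top.not_eq_extremum)
  finally have "(\<Sum>x\<in>T. \<bar>g x\<bar> powr a) \<le> enn2real ?I" by simp
  also have "\<dots> = enn2real (lnorm a S g) powr a"
    using I assms by (simp add: lnorm_def epowr_finite powr_powr)
  finally show ?thesis .
qed

text \<open>Monotone convergence along the dyadic boxes, which increase to the whole
  lattice.\<close>

lemma nn_integral_lattice_le:
  fixes g :: "int ^ 'n::finite \<Rightarrow> real"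
  assumes "\<And>x. g x \<ge> 0" and "\<And>T. finite T \<Longrightarrow> sum g T \<le> K"
  shows "(\<integral>\<^sup>+ x. ennreal (g x) \<partial>count_space UNIV) \<le> ennreal K"
proof -
  let ?g = "\<lambda>J x. ennreal (g x) * indicator (dyadic_box J) x"
  have "(SUP J. ?g J x) = ennreal (g x)" for x
  proof (rule antisym)
    obtain J where "x \<in> dyadic_box J" using finite_subset_dyadic_box[of "{x}"] by auto
    then show "ennreal (g x) \<le> (SUP J. ?g J x)" by (intro SUP_upper2[of J]) auto
  qed (auto intro!: SUP_least simp: indicator_def)
  then have "(\<integral>\<^sup>+ x. ennreal (g x) \<partial>count_space UNIV) = (\<integral>\<^sup>+ x. (SUP J. ?g J x) \<partial>count_space UNIV)"
    by simp
  also have "\<dots> = (SUP J. \<integral>\<^sup>+ x. ?g J x \<partial>count_space UNIV)"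
    by (rule nn_integral_monotone_convergence_SUP)
      (use dyadic_box_mono in \<open>auto simp: incseq_def le_fun_def indicator_def\<close>)
  also have "\<dots> \<le> ennreal K"
  proof (rule SUP_least)
    fix J
    have "(\<integral>\<^sup>+ x. ?g J x \<partial>count_space UNIV) = ennreal (sum g (dyadic_box J))"
      by (subst nn_integral_indicator_finite) (use assms in auto)
    then show "(\<integral>\<^sup>+ x. ?g J x \<partial>count_space UNIV) \<le> ennreal K"
      using assms by (simp add: ennreal_leI)
  qed
  finally show ?thesis .
qed

lemma lnorm_le:
  fixes g :: "int ^ 'n::finite \<Rightarrow> real"
  assumes "a > 0" "K \<ge> 0" and "\<And>T. finite T \<Longrightarrow> (\<Sum>x\<in>T. \<bar>g x\<bar> powr a) \<le> K powr a"
  shows "lnorm a UNIV g \<le> ennreal K"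
proof -
  let ?I = "\<integral>\<^sup>+ x. ennreal (\<bar>g x\<bar> powr a) \<partial>count_space UNIV"
  have le: "?I \<le> ennreal (K powr a)" by (rule nn_integral_lattice_le) (use assms in auto)
  then have I: "?I \<noteq> top" using le_less_trans[OF le] by (auto simp: less_top)
  have "enn2real ?I \<le> K powr a" using enn2real_mono[OF le] by simp
  then have "enn2real ?I powr (1 / a) \<le> (K powr a) powr (1 / a)" using assms by (intro powr_mono2) auto
  also have "\<dots> = K" using assms by (simp add: powr_powr)
  finally show ?thesis using I assms by (simp add: lnorm_def epowr_finite)
qed

lemma lnorm_nonzero:
  assumes "a > 0" "x \<in> S" "g x \<noteq> 0"
  shows "lnorm a S g \<noteq> 0"
proof
  assume "lnorm a S g = 0"
  with lnorm_bound[of a S g "{x}"] assms show False by simp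
qed

text \<open>Hoelder's inequality, obtained by summing Young's inequality for the sequences
  \<open>v e powr r / S\<close> and \<open>1 / n\<close>, each of which has total 1.\<close>

lemma power_mean_bound:
  fixes v :: "'a \<Rightarrow> real"
  assumes "finite Y" "\<And>e. e \<in> Y \<Longrightarrow> v e > 0" "r \<ge> 2"
  shows "(\<Sum>e\<in>Y. (v e)\<^sup>2) \<le> real (card Y) powr (1 - 2 / r) * (\<Sum>e\<in>Y. v e powr r) powr (2 / r)"
proof (cases "Y = {}")
  case False
  define S n where "S = (\<Sum>e\<in>Y. v e powr r)" and "n = real (card Y)"
  have "v e powr r > 0" if "e \<in> Y" for e using assms(2)[OF that] by simp
  then have S: "S > 0" unfolding S_def by (intro sum_pos assms(1) False)
  have n: "n > 0" using assms(1) False by (simp add: n_def card_gt_0_iff)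
  let ?c = "S powr (2 / r) * n powr (1 - 2 / r)"
  have "(v e)\<^sup>2 / ?c \<le> 2 / r * (v e powr r / S) + (1 - 2 / r) * (1 / n)" if "e \<in> Y" for e
  proof -
    have v: "v e > 0" by (rule assms(2)[OF that])
    have "(v e)\<^sup>2 / ?c = (v e powr r / S) powr (2 / r) * (1 / n) powr (1 - 2 / r)"
      using v S n assms(3) by (simp add: powr_divide powr_powr)
    also have "\<dots> \<le> 2 / r * (v e powr r / S) + (1 - 2 / r) * (1 / n)"
      using v S n assms(3) by (intro Youngs_inequality_0) auto
    finally show ?thesis .
  qed
  then have "(\<Sum>e\<in>Y. (v e)\<^sup>2 / ?c) \<le> (\<Sum>e\<in>Y. 2 / r * (v e powr r / S) + (1 - 2 / r) * (1 / n))"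
    by (rule sum_mono)
  also have "\<dots> = 2 / r * (S / S) + n * ((1 - 2 / r) * (1 / n))"
    by (simp add: sum.distrib S_def n_def flip: sum_distrib_left sum_divide_distrib)
  also have "\<dots> = 1" using S n by simp
  finally show ?thesis
    using S n by (simp add: S_def[symmetric] n_def[symmetric] divide_simps mult.commute flip: sum_divide_distrib)
qed auto

subsection \<open>The moment on dyadic boxes\<close>

definition step_edge :: "(int ^ 'n::finite) \<times> 'n \<Rightarrow> (int ^ 'n) set" where
  "step_edge e = {fst e, fst e + axis (snd e) 1}"

lemma step_edge_in_lattice_edges: "step_edge e \<in> lattice_edges"
proof -
  have "(\<chi> j. real_of_int ((fst e - (fst e + axis (snd e) 1)) $ j)) = - axis (snd e) 1"
    by (simp add: vec_eq_iff axis_def)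
  then have "znorm (fst e - (fst e + axis (snd e) 1)) = 1" by (simp add: znorm_def norm_eq_1 inner_axis_axis)
  then show ?thesis unfolding step_edge_def lattice_edges_def by blast
qed

text \<open>An edge points in a positive coordinate direction from only one endpoint: otherwise two
  standard unit vectors would add up to 0.\<close>

lemma inj_step_edge: "inj (step_edge :: (int ^ 'n::finite) \<times> 'n \<Rightarrow> _)"
proof (rule injI)
  fix a b :: "(int ^ 'n) \<times> 'n"
  obtain x i y j where ab: "a = (x, i)" "b = (y, j)" by (metis surj_pair)
  assume "step_edge a = step_edge b"
  then have "x = y \<and> x + axis i 1 = y + axis j 1 \<or> x = y + axis j 1 \<and> x + axis i 1 = y"
    by (auto simp: ab step_edge_def doubleton_eq_iff)
  then show "a = b"
  proof
    assume *: "x = y \<and> x + axis i 1 = y + axis j 1"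
    then have "axis i 1 = (axis j 1 :: int ^ 'n)" by (metis add_left_cancel)
    then show ?thesis using * by (simp add: ab axis_eq_axis)
  next
    assume "x = y + axis j 1 \<and> x + axis i 1 = y"
    then have "axis j 1 $ i + axis i 1 $ i = (0 :: int)"
      by (metis add.assoc add_cancel_left_right vector_add_component zero_index)
    then show ?thesis by (simp add: axis_def split: if_splits)
  qed
qed

lemma box_Z_eq_zbox: "box_Z r = zbox (\<chi> i. - int r) (sides {} (2 * int r + 1))"
  by (auto simp: box_Z_def zbox_def sides_def)

text \<open>An edge is given by an endpoint and a displacement with coordinates -1, 0 or 1. Per
  coordinate this crude count allows \<open>(2 * r + 1) * 3\<close>, at most \<open>9 * r\<close>,
  choices.\<close>

lemma box_edges_finite_card:
  assumes "r \<ge> 1"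
  shows "finite (box_edges r :: (int ^ 'n::finite) set set)"
    "card (box_edges r :: (int ^ 'n::finite) set set) \<le> (9 * r) ^ CARD('n)"
proof -
  let ?h = "\<lambda>(x :: int ^ 'n, v). {x, x + v}"
  have sub: "box_edges r \<subseteq> ?h ` (box_Z r \<times> box_Z 1)"
  proof
    fix e :: "(int ^ 'n) set" assume "e \<in> box_edges r"
    then obtain x y where e: "e = {x, y}" "znorm (x - y) = 1" "x \<in> box_Z r"
      by (auto simp: box_edges_def lattice_edges_def)
    have "\<bar>real_of_int ((x - y) $ i)\<bar> \<le> 1" for i
      using component_le_norm_cart[of "\<chi> i. real_of_int ((x - y) $ i)" i] e(2) by (simp add: znorm_def)
    then have "\<bar>(x - y) $ i\<bar> \<le> 1" for i by (metis of_int_abs of_int_le_1_iff)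
    then have "y - x \<in> box_Z 1" by (simp add: box_Z_def abs_le_iff) (smt (verit))
    then show "e \<in> ?h ` (box_Z r \<times> box_Z 1)"
      using e by (intro image_eqI[of _ _ "(x, y - x)"]) auto
  qed
  have fin: "finite (box_Z m :: (int ^ 'n) set)" for m by (simp add: box_Z_eq_zbox)
  then have fin2: "finite (?h ` (box_Z r \<times> box_Z 1))" by blast
  with sub show "finite (box_edges r :: (int ^ 'n) set set)" by (rule finite_subset)
  have "card (box_edges r :: (int ^ 'n) set set) \<le> card (?h ` (box_Z r \<times> box_Z 1))"
    by (rule card_mono[OF fin2 sub])
  also have "\<dots> \<le> card (box_Z r \<times> box_Z 1 :: ((int ^ 'n) \<times> (int ^ 'n)) set)"
    by (rule card_image_le) (use fin in blast)
  also have "\<dots> = nat (2 * int r + 1) ^ CARD('n) * 3 ^ CARD('n)"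
    by (simp add: card_cartesian_product box_Z_eq_zbox card_zbox_cube)
  also have "\<dots> = (nat (2 * int r + 1) * 3) ^ CARD('n)" by (simp add: power_mult_distrib)
  also have "\<dots> \<le> (9 * r) ^ CARD('n)" using assms by (intro power_mono) auto
  finally show "card (box_edges r :: (int ^ 'n) set set) \<le> (9 * r) ^ CARD('n)" .
qed

lemma dyadic_box_subset_box_Z: "dyadic_box J \<subseteq> box_Z (2 ^ J)"
  by (auto simp: mem_dyadic_box box_Z_def less_imp_le)

lemma lattice_edge_in_box:
  assumes "e \<in> lattice_edges"
  obtains J where "e \<in> box_edges (2 ^ J)"
proof -
  have "finite e" using assms by (auto simp: lattice_edges_def)
  then obtain J where "e \<subseteq> dyadic_box J" by (rule finite_subset_dyadic_box)
  then show ?thesis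
    using assms dyadic_box_subset_box_Z by (intro that[of J]) (auto simp: box_edges_def)
qed

text \<open>A zero weight contributes an infinite term to every box containing its edge, so a finite
  moment forces positive weights; \<open>epowr\<close> then agrees with the real power.\<close>

lemma moment_M_finite:
  fixes w :: "(int ^ 'n::finite) set \<Rightarrow> real"
  assumes top: "moment_M (ereal r) w \<noteq> top" and r: "r > 0" and w: "\<forall>e\<in>lattice_edges. w e \<ge> 0"
  defines "M \<equiv> enn2real (moment_M (ereal r) w)"
  shows "\<And>e. e \<in> lattice_edges \<Longrightarrow> w e > 0"
    and "\<And>m. m \<ge> 1 \<Longrightarrow> (\<Sum>e\<in>box_edges m. w e powr (- r)) \<le> card (box_edges m :: (int ^ 'n) set set) * M powr r"
proof -
  let ?B = "\<lambda>m. box_edges m :: (int ^ 'n) set set"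
  define S where "S = (SUP m\<in>{1..}. (\<Sum>e\<in>?B m. ennreal (w e) epowr (- r)) / of_nat (card (?B m)))"
  have M: "moment_M (ereal r) w = S epowr (1 / r)" by (simp add: moment_M_def S_def)
  then have S: "S \<noteq> top" using top r by (simp add: epowr_eq_top)
  have MS: "M powr r = enn2real S" using S r by (simp add: M_def M epowr_finite powr_powr)
  have le: "(\<Sum>e\<in>?B m. ennreal (w e) epowr (- r)) \<le> S * of_nat (card (?B m))" if "m \<ge> 1" for m
  proof (cases "card (?B m) = 0")
    case True
    then have "?B m = {}" using box_edges_finite_card(1)[OF that, where 'n = 'n] by simp
    then show ?thesis by simp
  next
    case False
    let ?x = "\<Sum>e\<in>?B m. ennreal (w e) epowr (- r)" and ?n = "of_nat (card (?B m)) :: ennreal"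
    have n: "?n \<noteq> 0" "?n \<noteq> top" using False by auto
    have "?x = ?x * ?n / ?n" using n by (simp add: ennreal_mult_divide_eq)
    also have "\<dots> = ?x / ?n * ?n" by (simp add: divide_ennreal_def mult_ac)
    also have "?x / ?n \<le> S" unfolding S_def by (rule SUP_upper) (use that in auto)
    finally show ?thesis by (simp add: mult_right_mono)
  qed
  show pos: "w e > 0" if e: "e \<in> lattice_edges" for e
  proof (rule ccontr)
    assume "\<not> w e > 0"
    then have "w e = 0" using w e by auto
    obtain J where J: "e \<in> ?B (2 ^ J)" using lattice_edge_in_box[OF e] .
    have "ennreal (w e) epowr (- r) \<le> (\<Sum>e\<in>?B (2 ^ J). ennreal (w e) epowr (- r))"
      using J by (intro member_le_sum box_edges_finite_card) auto
    also have "\<dots> \<le> S * of_nat (card (?B (2 ^ J)))" by (rule le) simp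
    also have "\<dots> < top" using S by (simp add: ennreal_mult_less_top less_top of_nat_less_top)
    finally show False using \<open>w e = 0\<close> r by (simp add: epowr_def)
  qed
  show "(\<Sum>e\<in>?B m. w e powr (- r)) \<le> card (?B m) * M powr r" if m: "m \<ge> 1" for m
  proof -
    have "ennreal (\<Sum>e\<in>?B m. w e powr (- r)) = (\<Sum>e\<in>?B m. ennreal (w e) epowr (- r))"
    proof (subst sum_ennreal[symmetric])
      show "(\<Sum>e\<in>?B m. ennreal (w e powr (- r))) = (\<Sum>e\<in>?B m. ennreal (w e) epowr (- r))"
      proof (rule sum.cong[OF refl])
        fix e assume "e \<in> ?B m"
        then have "w e > 0" using pos by (simp add: box_edges_def)
        then show "ennreal (w e powr (- r)) = ennreal (w e) epowr (- r)" using r by (simp add: epowr_def)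
      qed
    qed simp
    also have "\<dots> \<le> S * of_nat (card (?B m))" by (rule le[OF m])
    also have "\<dots> = ennreal (card (?B m) * M powr r)"
      unfolding MS using S by (simp add: ennreal_mult mult.commute ennreal_of_nat_eq_real_of_nat less_top)
    finally show ?thesis by (simp add: ennreal_le_iff)
  qed
qed

lemma moment_M_infinity:
  fixes w :: "(int ^ 'n::finite) set \<Rightarrow> real"
  assumes top: "moment_M \<infinity> w \<noteq> top" and w: "\<forall>e\<in>lattice_edges. w e \<ge> 0" and e: "e \<in> lattice_edges"
  shows "w e > 0" "1 / w e \<le> enn2real (moment_M \<infinity> w)"
proof -
  have "ennreal (w e) epowr (- 1) \<le> moment_M \<infinity> w"
    using SUP_upper[OF e, of "\<lambda>e. ennreal (w e) epowr (- 1)"] by (simp add: moment_M_def)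
  then have le: "ennreal (w e) epowr (- 1) \<le> moment_M \<infinity> w" "ennreal (w e) epowr (- 1) \<noteq> top"
    using top by (auto simp: top_unique)
  then have "w e \<noteq> 0" by (auto simp: epowr_def)
  then show pos: "w e > 0" using w e by auto
  then have "ennreal (w e) epowr (- 1) = ennreal (1 / w e)"
    by (simp add: epowr_def powr_minus_divide)
  with enn2real_mono[OF le(1)] top pos show "1 / w e \<le> enn2real (moment_M \<infinity> w)"
    by (simp add: less_top)
qed

lemma abs_powr_two: "\<bar>x :: real\<bar> powr 2 = x\<^sup>2"
  by (cases "x = 0") auto

text \<open>For finite q, Hoelder's inequality turns the q-th moment on the box of radius
  \<open>2 ^ J\<close> into the assumption of the locale. The edge count
  \<open>(9 * 2 ^ J) powr d\<close>, raised to the power \<kappa>, yields both the growth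
  \<open>2 powr (d * \<kappa> * J)\<close> and the constant in front of the moment.\<close>

lemma anchored_weight_of_moment:
  fixes f :: "int ^ 'n::finite \<Rightarrow> real" and w :: "(int ^ 'n) set \<Rightarrow> real" and d :: real
  assumes d: "real CARD('n) = d" "d \<ge> 2" and q: "q > ereal d"
    and w: "\<forall>e\<in>lattice_edges. w e \<ge> 0"
    and M: "moment_M q w \<noteq> top"
    and E: "lnorm 2 lattice_edges (\<lambda>e. w e * abs_grad f e) \<noteq> top"
  defines "\<kappa> \<equiv> if q = \<infinity> then 0 else 1 / real_of_ereal q"
  shows "anchored_weight f (w \<circ> step_edge) d \<kappa> ((9 powr d) powr \<kappa> * enn2real (moment_M q w))
    (enn2real (lnorm 2 lattice_edges (\<lambda>e. w e * abs_grad f e)))"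
proof -
  let ?u = "w \<circ> step_edge" and ?M = "enn2real (moment_M q w)"
  let ?E = "enn2real (lnorm 2 lattice_edges (\<lambda>e. w e * abs_grad f e))"
  have energy: "energy f ?u Y \<le> ?E\<^sup>2" if "finite Y" for Y
  proof -
    have "energy f ?u Y = (\<Sum>e\<in>step_edge ` Y. \<bar>w e * abs_grad f e\<bar> powr 2)"
      unfolding energy_def abs_powr_two
      by (subst sum.reindex) (auto simp: inj_on_subset[OF inj_step_edge] step_edge_def abs_grad_edge
          abs_minus_commute case_prod_unfold intro!: sum.cong)
    also have "\<dots> \<le> ?E powr 2"
      by (rule lnorm_bound[OF E]) (use that step_edge_in_lattice_edges in auto)
    finally show ?thesis using abs_powr_two[of ?E] by simp
  qed
  show ?thesis
  proof (cases "q = \<infinity>")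
    case True
    note inf = moment_M_infinity[OF M[unfolded True] w, of "step_edge _", OF step_edge_in_lattice_edges]
    show ?thesis
    proof
      fix Y :: "((int ^ 'n) \<times> 'n) set" and J
      have "(\<Sum>e\<in>Y. (1 / ?u e)\<^sup>2) \<le> (\<Sum>e\<in>Y. ?M\<^sup>2)"
        using inf by (intro sum_mono power_mono) (auto simp: True less_imp_le)
      then show "(\<Sum>e\<in>Y. (1 / ?u e)\<^sup>2)
        \<le> real (card Y) powr (1 - 2 * \<kappa>) * ((9 powr d) powr \<kappa> * ?M * 2 powr (d * \<kappa> * J))\<^sup>2"
        by (simp add: \<kappa>_def True)
    qed (use d inf energy in \<open>auto simp: \<kappa>_def True\<close>)
  next
    case False
    then obtain r where qr: "q = ereal r" and r: "r > d" using q by (cases q) auto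
    have r0: "r > 2" "r > 0" using r d by auto
    have \<kappa>: "\<kappa> = 1 / r" by (simp add: \<kappa>_def qr)
    note fin = moment_M_finite[OF M[unfolded qr] r0(2) w, folded qr]
    show ?thesis
    proof
      fix Y :: "((int ^ 'n) \<times> 'n) set" and J :: nat
      assume Y: "Y \<subseteq> steps (dyadic_box J)"
      have finY: "finite Y" by (rule finite_subset[OF Y]) simp
      let ?B = "box_edges (2 ^ J) :: (int ^ 'n) set set"
      have "(1 :: nat) \<le> 2 ^ J" by simp
      note B = box_edges_finite_card[OF this, where 'n = 'n]
      have sub: "step_edge ` Y \<subseteq> ?B"
        using Y dyadic_box_subset_box_Z[of J] step_edge_in_lattice_edges
        by (auto simp: box_edges_def steps_def step_edge_def subset_iff) blast+
      have u: "?u e > 0" for e using fin(1)[OF step_edge_in_lattice_edges] by simp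
      have "(\<Sum>e\<in>Y. (1 / ?u e) powr r) = (\<Sum>e\<in>step_edge ` Y. w e powr (- r))"
        using u by (subst sum.reindex)
          (auto simp: inj_on_subset[OF inj_step_edge] powr_divide powr_minus_divide less_imp_le intro!: sum.cong)
      also have "\<dots> \<le> (\<Sum>e\<in>?B. w e powr (- r))" by (intro sum_mono2 B sub) auto
      also have "\<dots> \<le> card ?B * ?M powr r" by (rule fin(2)) simp
      also have "\<dots> \<le> (9 * 2 ^ J) powr d * ?M powr r"
      proof (rule mult_right_mono)
        have "real (card ?B) \<le> real ((9 * 2 ^ J) ^ CARD('n))" using B(2) by (simp only: of_nat_le_iff)
        also have "\<dots> = (9 * 2 ^ J) powr d" by (simp add: d(1)[symmetric] powr_realpow)
        finally show "real (card ?B) \<le> (9 * 2 ^ J) powr d" .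
      qed simp
      finally have sum_le: "(\<Sum>e\<in>Y. (1 / ?u e) powr r) \<le> (9 * 2 ^ J) powr d * ?M powr r" .
      have "(\<Sum>e\<in>Y. (1 / ?u e)\<^sup>2)
          \<le> real (card Y) powr (1 - 2 / r) * (\<Sum>e\<in>Y. (1 / ?u e) powr r) powr (2 / r)"
        by (rule power_mean_bound[OF finY]) (use u r0 in auto)
      also have "\<dots> \<le> real (card Y) powr (1 - 2 / r) * ((9 * 2 ^ J) powr d * ?M powr r) powr (2 / r)"
        using sum_le r0 by (intro mult_left_mono powr_mono2 sum_nonneg) auto
      also have "((9 * 2 ^ J) powr d * ?M powr r) powr (2 / r)
          = ((9 powr d) powr \<kappa> * ?M * 2 powr (d * \<kappa> * J))\<^sup>2"
      proof -
        have "((9 * 2 ^ J) powr d * ?M powr r) powr (2 / r)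
          = (((9 * 2 powr J) powr d) powr (1 / r) * (?M powr r) powr (1 / r)) powr 2"
          by (simp add: powr_mult powr_powr powr_realpow)
        also have "(?M powr r) powr (1 / r) = ?M" using r0 by (simp add: powr_powr)
        also have "((9 * 2 powr J) powr d) powr (1 / r) = (9 powr d) powr \<kappa> * 2 powr (d * \<kappa> * J)"
          by (simp add: powr_mult powr_powr \<kappa> mult_ac)
        finally show ?thesis
          using abs_powr_two[of "(9 powr d) powr \<kappa> * 2 powr (d * \<kappa> * J) * ?M"] by (simp add: abs_mult mult_ac)
      qed
      finally show "(\<Sum>e\<in>Y. (1 / ?u e)\<^sup>2)
        \<le> real (card Y) powr (1 - 2 * \<kappa>) * ((9 powr d) powr \<kappa> * ?M * 2 powr (d * \<kappa> * J))\<^sup>2"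
        by (simp add: \<kappa>)
    qed (use d r r0 fin(1) step_edge_in_lattice_edges energy in \<open>auto simp: \<kappa>\<close>)
  qed
qed

subsection \<open>The anchored Nash inequality\<close>

theorem theorem2p1:
  fixes d :: nat and p \<theta> \<alpha> \<beta> \<gamma> :: real and q :: ereal
  assumes "CARD('n::finite) = d"
    and "d \<ge> 2"
    and "p > real d"
    and "q > ereal (real d)"
    and "theta_c (real d) p q \<le> \<theta>" and "\<theta> \<le> 1"
    and "\<alpha> = exp_alpha (real d) p \<theta>"
    and "\<beta> = exp_beta (real d) \<theta>"
    and "\<gamma> = exp_gamma p \<theta>"
  shows "\<exists>C::ennreal. C < top \<and>
    (\<forall>(f :: int ^ 'n \<Rightarrow> real) (w :: (int ^ 'n) set \<Rightarrow> real).
      (\<forall>e\<in>lattice_edges. w e \<ge> 0) \<longrightarrow>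
      lnorm 2 UNIV f
        \<le> C \<odot> (moment_M q w \<odot> lnorm 2 lattice_edges (\<lambda>e. w e * abs_grad f e)) epowr \<alpha>
            \<odot> lnorm 1 UNIV f epowr \<beta>
            \<odot> lnorm 2 UNIV (\<lambda>x. znorm_star x powr (p / 2) * f x) epowr \<gamma>)"
proof -
  define \<kappa> where "\<kappa> = (if q = \<infinity> then 0 else 1 / real_of_ereal q)"
  define c where "c = 3 * anchored_weight.c\<^sub>2 (real d) \<kappa> p"
  define m where "m = (9 powr real d) powr \<kappa>"
  \<comment> \<open>The square root undoes the square in \<open>nash\<close>, and
    \<open>m powr \<alpha>\<close> takes \<open>m\<close> out of the gradient term. The absolute
    value makes \<open>C\<close> nonnegative at once; the lower bounds for \<open>c\<^sub>2\<close>
    are available only inside the locale.\<close>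
  define C where "C = sqrt \<bar>c\<bar> * m powr \<alpha>"
  have d: "real CARD('n) = real d" "real d \<ge> 2" "real d > 0" and p: "p > 0" "p \<ge> 0" using assms by auto
  have crit: "crit (real d) p \<kappa> \<le> \<theta>"
    using theta_c_eq_crit[OF d(3) p(1) assms(4)] assms(5) by (simp add: \<kappa>_def)
  have \<theta>0: "0 \<le> \<theta>" using theta_c_bounds[OF d(3) p(1) assms(4)] assms(5) by simp
  have \<alpha>: "\<alpha> > 0" using d p \<theta>0 assms(6) unfolding assms(7) exp_alpha_def
    by (cases "\<theta> = 1") (auto intro!: add_pos_nonneg mult_pos_pos divide_pos_pos)
  have \<beta>: "\<beta> \<ge> 0" and \<gamma>: "\<gamma> \<ge> 0"
    using exponent_bounds[OF d(3) p(1) \<theta>0 assms(6)] assms(8,9) by auto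
  have \<beta>0: "\<beta> > 0" if "\<theta> < 1" using that d unfolding assms(8) exp_beta_def by simp
  have \<gamma>0: "\<gamma> > 0" if "\<theta> > 0" using that p unfolding assms(9) exp_gamma_def by simp
  have "lnorm 2 UNIV f
        \<le> ennreal C \<odot> (moment_M q w \<odot> lnorm 2 lattice_edges (\<lambda>e. w e * abs_grad f e)) epowr \<alpha>
            \<odot> lnorm 1 UNIV f epowr \<beta>
            \<odot> lnorm 2 UNIV (\<lambda>x. znorm_star x powr (p / 2) * f x) epowr \<gamma>"
    (is "_ \<le> _ \<odot> (?M \<odot> ?E) epowr \<alpha> \<odot> ?N epowr \<beta> \<odot> ?W epowr \<gamma>")
    if w: "\<forall>e\<in>lattice_edges. w e \<ge> 0" for f :: "int ^ 'n \<Rightarrow> real" and w :: "(int ^ 'n) set \<Rightarrow> real"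
  \<comment> \<open>Both alternatives are trivial. Otherwise the powers on the right are finite and,
    as \<open>f\<close> does not vanish, \<open>?N\<close> and \<open>?W\<close> are nonzero, so
    positive \<open>N\<close> and \<open>W\<close> can be chosen below.\<close>
  proof (cases "(\<forall>x. f x = 0) \<or> ennreal C \<odot> (?M \<odot> ?E) epowr \<alpha> \<odot> ?N epowr \<beta> \<odot> ?W epowr \<gamma> = top")
    case True
    have "lnorm 2 UNIV f = 0" if "\<forall>x. f x = 0" using that by (simp add: lnorm_def epowr_def)
    with True show ?thesis by auto
  next
    case False
    then obtain x where x: "f x \<noteq> 0" by blast
    have nt: "?M \<noteq> top" "?E \<noteq> top" "?N epowr \<beta> \<noteq> top" "?W epowr \<gamma> \<noteq> top"
      using False \<alpha> by (auto simp: itimes_eq_top epowr_eq_top)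
    have z: "znorm_star y > 0" for y :: "int ^ 'n" by (simp add: znorm_star_def)
    have N0: "?N \<noteq> 0" by (rule lnorm_nonzero[of 1 x]) (use x in auto)
    have W0: "?W \<noteq> 0" by (rule lnorm_nonzero[of 2 x]) (use x z[of x] in auto)
    have "?N \<noteq> top" if "\<beta> > 0" using nt(3) epowr_eq_top[OF that] by simp
    then obtain N where N: "N > 0" "?N epowr \<beta> = ennreal (N powr \<beta>)" "\<beta> > 0 \<Longrightarrow> ?N = ennreal N"
      using epowr_pos[OF \<beta> N0] by blast
    have "?W \<noteq> top" if "\<gamma> > 0" using nt(4) epowr_eq_top[OF that] by simp
    then obtain W where W: "W > 0" "?W epowr \<gamma> = ennreal (W powr \<gamma>)" "\<gamma> > 0 \<Longrightarrow> ?W = ennreal W"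
      using epowr_pos[OF \<gamma> W0] by blast
    interpret anchored_weight f "w \<circ> step_edge" "real d" \<kappa> "m * enn2real ?M" "enn2real ?E"
      unfolding m_def \<kappa>_def by (rule anchored_weight_of_moment[OF d(1,2) assms(4) _ nt(1,2)]) (use w in auto)
    have sum: "sum_bound N" if "\<theta> < 1"
    proof -
      have N': "?N = ennreal N" by (rule N(3)[OF \<beta>0[OF that]])
      show ?thesis unfolding sum_bound_def
        using lnorm_bound[of 1 UNIV f] N(1) unfolding N' by (auto simp: powr_one_gt_zero_iff)
    qed
    have weight: "weight_bound p W" if "\<theta> > 0"
    proof -
      have W': "?W = ennreal W" by (rule W(3)[OF \<gamma>0[OF that]])
      have "(\<Sum>x\<in>S. znorm_star x powr p * (f x)\<^sup>2) = (\<Sum>x\<in>S. \<bar>znorm_star x powr (p / 2) * f x\<bar> powr 2)" for S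
        unfolding abs_powr_two by (intro sum.cong refl)
          (simp add: power_mult_distrib power2_eq_square flip: powr_add)
      then show ?thesis unfolding weight_bound_def
        using lnorm_bound[of 2 UNIV "\<lambda>x. znorm_star x powr (p / 2) * f x"] W(1) abs_powr_two[of W]
        unfolding W' by simp
    qed
    define D where "D = enn2real ?M * enn2real ?E"
    let ?K = "C * D powr \<alpha> * N powr \<beta> * W powr \<gamma>"
    have c0: "c \<ge> 0" using c\<^sub>2_ge(2)[of p] by (simp add: c_def)
    have prod: "c * (nash_product (real d) p \<theta> (m * enn2real ?M * enn2real ?E) N W)\<^sup>2 = ?K\<^sup>2"
    proof -
      have "nash_product (real d) p \<theta> (m * enn2real ?M * enn2real ?E) N W
         = m powr \<alpha> * D powr \<alpha> * N powr \<beta> * W powr \<gamma>"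
        unfolding nash_product_def assms(7-9)[symmetric] D_def
        by (simp add: powr_mult m_def mult.assoc)
      then show ?thesis using c0 by (simp add: C_def power_mult_distrib mult_ac)
    qed
    have "lnorm 2 UNIV f \<le> ennreal ?K"
    proof (rule lnorm_le)
      show K0: "?K \<ge> 0" by (simp add: C_def)
      fix T :: "(int ^ 'n) set" assume "finite T"
      from nash[OF weight sum p(1) crit assms(6) this W(1) N(1)]
      have "(\<Sum>x\<in>T. (f x)\<^sup>2) \<le> ?K\<^sup>2" unfolding c_def[symmetric] prod .
      then show "(\<Sum>x\<in>T. \<bar>f x\<bar> powr 2) \<le> ?K powr 2"
        using abs_powr_two[of ?K] K0 by (simp add: abs_powr_two)
    qed simp
    also have "ennreal ?K = ennreal C \<odot> (?M \<odot> ?E) epowr \<alpha> \<odot> ?N epowr \<beta> \<odot> ?W epowr \<gamma>"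
    proof -
      have "?M = ennreal (enn2real ?M)" "?E = ennreal (enn2real ?E)" using nt by (simp_all add: less_top)
      then have "?M \<odot> ?E = ennreal D" unfolding D_def by (metis itimes_ennreal enn2real_nonneg)
      then have "(?M \<odot> ?E) epowr \<alpha> = ennreal (D powr \<alpha>)"
        using \<alpha> by (simp add: epowr_finite D_def)
      moreover have "C \<ge> 0" by (simp add: C_def)
      ultimately show ?thesis unfolding N(2) W(2) by (simp add: itimes_ennreal)
    qed
    finally show ?thesis .
  qed
  then show ?thesis by (intro exI[of _ "ennreal C"]) auto
qed

end
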